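(* Let $\mathrm{EF}(c)=\{p(\cdot,\theta)=\exp(\theta'c-\psi(\theta)):\theta\in\Theta\}$ be an exponential family such that $$\sup_{t\ge 0}E_\theta\left[\left|\frac{\mathcal L_t^\ast p(\cdot,\theta)}{p(\cdot,\theta)}\right|^2\right]<\infty\quad\text{for all }\theta\in\Theta .$$ Then closing the evolution equation $\frac{d}{dt}E_{p_t}[c]=E_{p_t}[\mathcal L_tc]$ of the relative entropy metric projection onto $\mathrm{EF}(c)$ of the solution $p_t$ of the Fokker-Planck-Kolmogorov equation, by forcing an exponential density on the right hand side (assumed density approximation), is equivalent to the locally optimal Hellinger approximation given by tangent projection of the vector field in Fisher metric. Precisely: a differentiable curve $t\mapsto\theta_t\in\Theta$ satisfies the tangent projected equation $$\frac{d}{dt}\sqrt{p(\cdot,\theta_t)}=\Pi^g_{\theta_t}\left[\frac{\mathcal L_t^\ast p(\cdot,\theta_t)}{2\sqrt{p(\cdot,\theta_t)}}\right]$$ if and only if the corresponding expectation parameters $\eta_t=\eta(\theta_t)=E_{\theta_t}[c]$ satisfy the assumed density equation $$\dot\eta_t=E_{\eta_t}[\mathcal L_tc].$$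
   Context: Consider the stochastic differential equation $dX_t=f(X_t,t)\,dt+\sigma(X_t,t)\,dW_t$ in $\mathbb R^N$, and let $a=\sigma\sigma'$ (prime denotes transpose). The Fokker-Planck-Kolmogorov (FPK) equation for the density $p_t$ of $X_t$ is $\partial_tp_t=\mathcal L_t^\ast p_t$; the FPK operator and its formal adjoint are $$\mathcal L_t^\ast p=-\sum_{i=1}^N\frac{\partial}{\partial x_i}[f_i(\cdot,t)p]+\frac12\sum_{i,j=1}^N\frac{\partial^2}{\partial x_i\partial x_j}[a_{ij}(\cdot,t)p],\qquad \mathcal L_t\varphi=\sum_{i=1}^N f_i(\cdot,t)\frac{\partial\varphi}{\partial x_i}+\frac12\sum_{i,j=1}^N a_{ij}(\cdot,t)\frac{\partial^2\varphi}{\partial x_i\partial x_j};$$ $\mathcal L$ is applied componentwise to vectors. Exponential family: $c=(c_1,\dots,c_n)'$ are real functions on $\mathbb R^N$, $\Theta\subset\mathbb R^n$ is open and convex, $p(x,\theta)=\exp(\theta'c(x)-\psi(\theta))$ is a probability density for each $\theta\in\Theta$, $\psi(\theta)$ being the normalizing constant. $E_\theta[\varphi]=\int\varphi(x)p(x,\theta)\,dx$, $E_p[\varphi]=\int\varphi(x)p(x)\,dx$. The expectation parameters are $\eta(\theta)=E_\theta[c]=\nabla\psi(\theta)$; $p(\cdot;\eta)$ denotes the member of the family with expectation parameters $\eta$, and $E_\eta$ expectation under it. The Fisher matrix is $g_{ij}(\theta)=\partial^2_{\theta_i\theta_j}\psi(\theta)=4\left\langle\partial_{\theta_i}\sqrt{p(\cdot,\theta)},\partial_{\theta_j}\sqrt{p(\cdot,\theta)}\right\rangle$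 ($L^2$ inner product), assumed positive definite, with inverse entries $g^{ij}$. The tangent projection in Hellinger metric of $v\in L^2$ is $$\Pi^g_\theta[v]=\sum_{i=1}^n\left[\sum_{j=1}^n4g^{ij}(\theta)\left\langle v,\frac{1}{2\sqrt{p(\cdot,\theta)}}\frac{\partial p(\cdot,\theta)}{\partial\theta_j}\right\rangle\right]\frac{1}{2\sqrt{p(\cdot,\theta)}}\frac{\partial p(\cdot,\theta)}{\partial\theta_i}.$$ The relative entropy metric projection of a density $p$ onto $\mathrm{EF}(c)$ is the density in $\mathrm{EF}(c)$ with expectation parameters $\tilde\eta=E_p[c]$; for $p=p_t$ one has $\frac{d}{dt}\tilde\eta_t=E_{p_t}[\mathcal L_tc]$. The assumed density approximation replaces, in this equation, $\tilde\eta_t$ by $\eta_t$ on the left and $p_t$ by $p(\cdot;\eta_t)$ on the right. Standing convention: integration by parts is legitimate, i.e. $\int\varphi\,\mathcal L_t^\ast p(\cdot,\theta)\,dx=\int(\mathcal L_t\varphi)\,p(\cdot,\theta)\,dx$ for $\varphi=1,c_1,\dots,c_n$. *)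

theory Defs
  imports "HOL-Analysis.Analysis"
begin

definition partial_deriv :: "'k::finite \<Rightarrow> (real ^ 'k \<Rightarrow> real) \<Rightarrow> real ^ 'k \<Rightarrow> real" where
  "partial_deriv i \<phi> x = deriv (\<lambda>h. \<phi> (x + h *\<^sub>R axis i 1)) 0"

definition diffusion_matrix ::
  "(real ^ 'N \<Rightarrow> real \<Rightarrow> real ^ 'm ^ 'N) \<Rightarrow> real \<Rightarrow> real ^ 'N \<Rightarrow> real ^ 'N ^ 'N" where
  "diffusion_matrix \<sigma> t x = \<sigma> x t ** transpose (\<sigma> x t)"

definition FPK_operator ::
  "(real ^ 'N \<Rightarrow> real \<Rightarrow> real ^ 'N) \<Rightarrow> (real ^ 'N \<Rightarrow> real \<Rightarrow> real ^ 'm ^ 'N) \<Rightarrow> real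
    \<Rightarrow> (real ^ 'N \<Rightarrow> real) \<Rightarrow> real ^ 'N \<Rightarrow> real" where
  "FPK_operator f \<sigma> t p x =
     - (\<Sum>i\<in>UNIV. partial_deriv i (\<lambda>y. f y t $ i * p y) x)
     + 1 / 2 * (\<Sum>i\<in>UNIV. \<Sum>j\<in>UNIV.
         partial_deriv i (partial_deriv j (\<lambda>y. diffusion_matrix \<sigma> t y $ i $ j * p y)) x)"

definition FPK_adjoint ::
  "(real ^ 'N \<Rightarrow> real \<Rightarrow> real ^ 'N) \<Rightarrow> (real ^ 'N \<Rightarrow> real \<Rightarrow> real ^ 'm ^ 'N) \<Rightarrow> real
    \<Rightarrow> (real ^ 'N \<Rightarrow> real) \<Rightarrow> real ^ 'N \<Rightarrow> real" where
  "FPK_adjoint f \<sigma> t \<phi> x =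
     (\<Sum>i\<in>UNIV. f x t $ i * partial_deriv i \<phi> x)
     + 1 / 2 * (\<Sum>i\<in>UNIV. \<Sum>j\<in>UNIV.
         diffusion_matrix \<sigma> t x $ i $ j * partial_deriv i (partial_deriv j \<phi>) x)"

definition FPK_adjoint_vec ::
  "(real ^ 'N \<Rightarrow> real \<Rightarrow> real ^ 'N) \<Rightarrow> (real ^ 'N \<Rightarrow> real \<Rightarrow> real ^ 'm ^ 'N) \<Rightarrow> real
    \<Rightarrow> (real ^ 'N \<Rightarrow> real ^ 'n) \<Rightarrow> real ^ 'N \<Rightarrow> real ^ 'n" where
  "FPK_adjoint_vec f \<sigma> t c x = (\<chi> k. FPK_adjoint f \<sigma> t (\<lambda>y. c y $ k) x)"

definition log_partition :: "(real ^ 'N \<Rightarrow> real ^ 'n) \<Rightarrow> real ^ 'n \<Rightarrow> real" where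
  "log_partition c \<theta> = ln (LINT x|lborel. exp (\<theta> \<bullet> c x))"

definition ef_density :: "(real ^ 'N \<Rightarrow> real ^ 'n) \<Rightarrow> real ^ 'n \<Rightarrow> real ^ 'N \<Rightarrow> real" where
  "ef_density c \<theta> x = exp (\<theta> \<bullet> c x - log_partition c \<theta>)"

definition probability_density :: "(real ^ 'N \<Rightarrow> real) \<Rightarrow> bool" where
  "probability_density p \<longleftrightarrow> (\<forall>x. 0 \<le> p x) \<and> has_bochner_integral lborel p 1"

definition exponential_family :: "(real ^ 'N \<Rightarrow> real ^ 'n) \<Rightarrow> (real ^ 'n) set \<Rightarrow> bool" where
  "exponential_family c \<Theta> \<longleftrightarrow>
     open \<Theta> \<and> convex \<Theta> \<and> (\<forall>\<theta>\<in>\<Theta>. probability_density (ef_density c \<theta>))"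

definition expect ::
  "(real ^ 'N \<Rightarrow> real) \<Rightarrow> (real ^ 'N \<Rightarrow> 'b) \<Rightarrow> 'b::{banach, second_countable_topology}" where
  "expect p \<phi> = (LINT x|lborel. p x *\<^sub>R \<phi> x)"

definition expectation_param :: "(real ^ 'N \<Rightarrow> real ^ 'n) \<Rightarrow> real ^ 'n \<Rightarrow> real ^ 'n" where
  "expectation_param c \<theta> = expect (ef_density c \<theta>) c"

text \<open>The member \<open>p(\<cdot>;\<eta>)\<close> of the family with expectation parameters \<open>\<eta>\<close>. The description
  is proper for \<open>\<eta>\<close> in the image of \<open>\<Theta>\<close> when the Fisher matrix is positive definite on the
  convex set \<open>\<Theta>\<close>, since \<open>\<theta> \<mapsto> \<eta>(\<theta>)\<close> is then injective.\<close>

definition ef_density_of_expectation ::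
  "(real ^ 'N \<Rightarrow> real ^ 'n) \<Rightarrow> (real ^ 'n) set \<Rightarrow> real ^ 'n \<Rightarrow> real ^ 'N \<Rightarrow> real" where
  "ef_density_of_expectation c \<Theta> \<eta> =
     (THE p. \<exists>\<theta>\<in>\<Theta>. expectation_param c \<theta> = \<eta> \<and> p = ef_density c \<theta>)"

definition fisher_matrix :: "(real ^ 'N \<Rightarrow> real ^ 'n) \<Rightarrow> real ^ 'n \<Rightarrow> real ^ 'n ^ 'n" where
  "fisher_matrix c \<theta> = (\<chi> i j. partial_deriv i (partial_deriv j (log_partition c)) \<theta>)"

definition pos_definite :: "real ^ 'n ^ 'n \<Rightarrow> bool" where
  "pos_definite A \<longleftrightarrow> (\<forall>v. v \<noteq> 0 \<longrightarrow> 0 < v \<bullet> (A *v v))"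

definition L2_fun :: "(real ^ 'N \<Rightarrow> real) \<Rightarrow> bool" where
  "L2_fun u \<longleftrightarrow> u \<in> borel_measurable lborel \<and> integrable lborel (\<lambda>x. (u x)\<^sup>2)"

definition L2_inner :: "(real ^ 'N \<Rightarrow> real) \<Rightarrow> (real ^ 'N \<Rightarrow> real) \<Rightarrow> real" where
  "L2_inner u v = (LINT x|lborel. u x * v x)"

definition L2_norm :: "(real ^ 'N \<Rightarrow> real) \<Rightarrow> real" where
  "L2_norm u = sqrt (L2_inner u u)"

text \<open>The derivative at time \<open>t\<close> of a curve \<open>F\<close> in \<open>L\<^sup>2\<close> defined on \<open>T\<close>: the difference
  quotients converge to \<open>V\<close> in \<open>L\<^sup>2\<close> norm (so \<open>V\<close> is determined almost everywhere).\<close>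

definition has_L2_derivative ::
  "(real \<Rightarrow> real ^ 'N \<Rightarrow> real) \<Rightarrow> (real ^ 'N \<Rightarrow> real) \<Rightarrow> real \<Rightarrow> real set \<Rightarrow> bool" where
  "has_L2_derivative F V t T \<longleftrightarrow>
     (\<forall>s\<in>T. L2_fun (F s)) \<and> L2_fun V \<and>
     ((\<lambda>s. L2_norm (\<lambda>x. (F s x - F t x) / (s - t) - V x)) \<longlongrightarrow> 0) (at t within T)"

definition sqrt_tangent :: "(real ^ 'N \<Rightarrow> real ^ 'n) \<Rightarrow> real ^ 'n \<Rightarrow> 'n \<Rightarrow> real ^ 'N \<Rightarrow> real" where
  "sqrt_tangent c \<theta> i x =
     1 / (2 * sqrt (ef_density c \<theta> x)) * partial_deriv i (\<lambda>\<theta>'. ef_density c \<theta>' x) \<theta>"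

definition tangent_projection ::
  "(real ^ 'N \<Rightarrow> real ^ 'n) \<Rightarrow> real ^ 'n \<Rightarrow> (real ^ 'N \<Rightarrow> real) \<Rightarrow> real ^ 'N \<Rightarrow> real" where
  "tangent_projection c \<theta> v x =
     (\<Sum>i\<in>UNIV. (\<Sum>j\<in>UNIV. 4 * matrix_inv (fisher_matrix c \<theta>) $ i $ j
                          * L2_inner v (sqrt_tangent c \<theta> j)) * sqrt_tangent c \<theta> i x)"

text \<open>The identity \<open>\<integral> \<phi> \<L>\<^sub>t\<^sup>* p = \<integral> (\<L>\<^sub>t \<phi>) p\<close>, including the existence of both integrals.\<close>

definition integration_by_parts ::
  "(real ^ 'N \<Rightarrow> real \<Rightarrow> real ^ 'N) \<Rightarrow> (real ^ 'N \<Rightarrow> real \<Rightarrow> real ^ 'm ^ 'N) \<Rightarrow> real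
    \<Rightarrow> (real ^ 'N \<Rightarrow> real) \<Rightarrow> (real ^ 'N \<Rightarrow> real) \<Rightarrow> bool" where
  "integration_by_parts f \<sigma> t p \<phi> \<longleftrightarrow>
     integrable lborel (\<lambda>x. \<phi> x * FPK_operator f \<sigma> t p x) \<and>
     integrable lborel (\<lambda>x. FPK_adjoint f \<sigma> t \<phi> x * p x) \<and>
     (LINT x|lborel. \<phi> x * FPK_operator f \<sigma> t p x) = (LINT x|lborel. FPK_adjoint f \<sigma> t \<phi> x * p x)"

text \<open>The equation \<open>d\<eta>\<^sub>t/dt = E\<^bsub>q\<^sub>t\<^esub>[\<L>\<^sub>t c]\<close> on the time set \<open>T\<close>. For \<open>q\<close> the solution of the
  Fokker-Planck-Kolmogorov equation it is the evolution equation of the expectation parameters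
  of the relative entropy projection of \<open>q\<close>; the assumed density approximation closes it by
  taking for \<open>q\<^sub>t\<close> the member of the family with expectation parameters \<open>\<eta>\<^sub>t\<close>.\<close>

definition moment_equation ::
  "(real ^ 'N \<Rightarrow> real \<Rightarrow> real ^ 'N) \<Rightarrow> (real ^ 'N \<Rightarrow> real \<Rightarrow> real ^ 'm ^ 'N)
    \<Rightarrow> (real ^ 'N \<Rightarrow> real ^ 'n) \<Rightarrow> real set \<Rightarrow> (real \<Rightarrow> real ^ 'N \<Rightarrow> real)
    \<Rightarrow> (real \<Rightarrow> real ^ 'n) \<Rightarrow> bool" where
  "moment_equation f \<sigma> c T q \<eta> \<longleftrightarrow>
     (\<forall>t\<in>T. (\<eta> has_vector_derivative expect (q t) (FPK_adjoint_vec f \<sigma> t c)) (at t within T))"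

definition assumed_density_equation ::
  "(real ^ 'N \<Rightarrow> real \<Rightarrow> real ^ 'N) \<Rightarrow> (real ^ 'N \<Rightarrow> real \<Rightarrow> real ^ 'm ^ 'N)
    \<Rightarrow> (real ^ 'N \<Rightarrow> real ^ 'n) \<Rightarrow> (real ^ 'n) set \<Rightarrow> real set
    \<Rightarrow> (real \<Rightarrow> real ^ 'n) \<Rightarrow> bool" where
  "assumed_density_equation f \<sigma> c \<Theta> T \<eta> \<longleftrightarrow>
     moment_equation f \<sigma> c T (\<lambda>t. ef_density_of_expectation c \<Theta> (\<eta> t)) \<eta>"

definition tangent_projected_equation ::
  "(real ^ 'N \<Rightarrow> real \<Rightarrow> real ^ 'N) \<Rightarrow> (real ^ 'N \<Rightarrow> real \<Rightarrow> real ^ 'm ^ 'N)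
    \<Rightarrow> (real ^ 'N \<Rightarrow> real ^ 'n) \<Rightarrow> real set \<Rightarrow> (real \<Rightarrow> real ^ 'n) \<Rightarrow> bool" where
  "tangent_projected_equation f \<sigma> c T \<theta> \<longleftrightarrow>
     (\<forall>t\<in>T. has_L2_derivative (\<lambda>s x. sqrt (ef_density c (\<theta> s) x))
        (tangent_projection c (\<theta> t)
          (\<lambda>x. FPK_operator f \<sigma> t (ef_density c (\<theta> t)) x / (2 * sqrt (ef_density c (\<theta> t) x))))
        t T)"

end

theory Submission
  imports Defs
begin

text \<open>
  Write \<open>p\<close> for the density at \<open>\<theta>\<close>, \<open>\<eta>\<close> for its expectation parameters, \<open>g\<close> (in the lemmas \<open>F\<close>)
  for the Fisher matrix and \<open>b\<close> for the expectation of \<open>\<L>c\<close> under \<open>p\<close>. Both equations say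
  \<open>g \<theta>' = b\<close> at every time, unless the time set is a single point, where both are void.

  The tangent vectors of the family of square roots \<open>\<surd>p\<close> are
  \<open>s\<^sub>i = \<surd>p (c\<^sub>i - \<eta>\<^sub>i) / 2\<close>. Since the Fisher matrix is the covariance matrix of \<open>c\<close>, the
  squared norm of \<open>\<Sum> w\<^sub>i s\<^sub>i\<close> is \<open>w \<bullet> g w / 4\<close>; as \<open>g\<close> is positive definite, the coordinates \<open>w\<close>
  of a tangent vector are determined by its class in \<open>L\<^sup>2\<close>. The curve \<open>\<surd>p\<close> has
  derivative \<open>\<Sum> \<theta>'\<^sub>i s\<^sub>i\<close> in \<open>L\<^sup>2\<close> (lemma \<open>sqrt_density_has_L2_derivative\<close>). The projected vector
  field has the coordinates \<open>g\<^sup>-\<^sup>1 b\<close>, because pairing \<open>\<L>\<^sup>*p / (2 \<surd>p)\<close> with \<open>4 s\<^sub>j\<close> gives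
  \<open>\<integral> (c\<^sub>j - \<eta>\<^sub>j) \<L>\<^sup>*p\<close>, and moving the operator to the other factor turns this into \<open>b\<^sub>j\<close>, the
  constant \<open>\<eta>\<^sub>j\<close> being annihilated by \<open>\<L>\<close> (lemma \<open>L2_inner_sqrt_tangent_FPK_operator\<close>). So the
  tangent projected equation is \<open>\<theta>' = g\<^sup>-\<^sup>1 b\<close>.

  On the other side \<open>\<eta>\<close> is differentiable in \<open>\<theta>\<close> with Jacobian \<open>g\<close> (lemma
  \<open>expectation_param_has_derivative\<close>), so \<open>\<eta>\<close> moves along the curve with velocity \<open>g \<theta>'\<close>, and
  since \<open>\<theta> \<mapsto> \<eta>\<close> is injective, the density that closes the moment equation is \<open>p\<close> itself. So the
  assumed density equation is \<open>g \<theta>' = b\<close>.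

  The analysis behind the derivatives rests on one observation: as the parameter set is open,
  \<open>exp (\<theta> \<bullet> c)\<close> remains integrable after multiplication by \<open>exp (\<epsilon> |c|)\<close> for a small \<open>\<epsilon>\<close>, and
  this factor dominates every power of \<open>|c|\<close> and the Taylor remainders of the exponential.\<close>

section \<open>Exponential integrals and their derivatives\<close>

lemma exp_remainder_le: "\<bar>exp u - 1 - u\<bar> \<le> u\<^sup>2 * exp \<bar>u\<bar>" for u :: real
proof -
  obtain t where t: "\<bar>t\<bar> \<le> \<bar>u\<bar>" "exp u = (\<Sum>m<2. u ^ m / fact m) + exp t / fact 2 * u ^ 2"
    using Maclaurin_exp_le[of u 2] by blast
  have "exp u - 1 - u = exp t / 2 * u\<^sup>2"
    using t(2) by (simp add: numeral_2_eq_2)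
  then have "\<bar>exp u - 1 - u\<bar> = \<bar>exp t / 2 * u\<^sup>2\<bar>"
    by (rule arg_cong)
  then have "\<bar>exp u - 1 - u\<bar> = exp t / 2 * u\<^sup>2"
    by (simp add: abs_mult)
  also have "\<dots> \<le> exp \<bar>u\<bar> * u\<^sup>2"
    using t(1) exp_le_cancel_iff[of t "\<bar>u\<bar>"] exp_gt_zero[of t] by (intro mult_right_mono) (linarith | simp)+
  finally show ?thesis by (simp add: mult.commute)
qed

lemma power_le_exp:
  fixes r \<delta> :: real
  assumes "0 < \<delta>" "0 \<le> r"
  shows "r ^ k \<le> (real k / \<delta>) ^ k * exp (\<delta> * r)"
proof (cases "k = 0")
  case False
  have "(\<delta> * r / real k) ^ k \<le> exp (\<delta> * r / real k) ^ k"
    using assms by (intro power_mono order_trans[OF _ exp_ge_add_one_self]) auto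
  also have "\<dots> = exp (\<delta> * r)"
    using False by (simp flip: exp_of_nat_mult)
  finally have "(real k / \<delta>) ^ k * (\<delta> * r / real k) ^ k \<le> (real k / \<delta>) ^ k * exp (\<delta> * r)"
    using assms by (intro mult_left_mono) auto
  then show ?thesis
    using assms False by (simp flip: power_mult_distrib)
qed (use assms in simp)

text \<open>A power of the norm is absorbed by a loss in the exponent, however small; all
  integrability and domination statements below reduce to this one.\<close>
lemma integrable_norm_power_exp:
  fixes c :: "'a \<Rightarrow> 'v::euclidean_space" and w :: "'a \<Rightarrow> real"
  assumes [measurable]: "c \<in> borel_measurable M" "w \<in> borel_measurable M"
    and int: "integrable M (\<lambda>x. w x * exp (\<epsilon> * norm (c x)))"
    and "\<delta> < \<epsilon>"
  shows "integrable M (\<lambda>x. w x * norm (c x) ^ k * exp (\<delta> * norm (c x)))"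
proof -
  define C where "C = (real k / (\<epsilon> - \<delta>)) ^ k"
  show ?thesis
  proof (rule Bochner_Integration.integrable_bound)
    show "integrable M (\<lambda>x. C * (w x * exp (\<epsilon> * norm (c x))))"
      using int by simp
    have "norm (c x) ^ k * exp (\<delta> * norm (c x)) \<le> C * exp (\<epsilon> * norm (c x))" for x
    proof -
      have "norm (c x) ^ k * exp (\<delta> * norm (c x))
        \<le> (C * exp ((\<epsilon> - \<delta>) * norm (c x))) * exp (\<delta> * norm (c x))"
        unfolding C_def using assms by (intro mult_right_mono power_le_exp) auto
      then show ?thesis by (simp add: mult.assoc left_diff_distrib flip: exp_add)
    qed
    then have "\<bar>w x\<bar> * (norm (c x) ^ k * exp (\<delta> * norm (c x))) \<le> \<bar>w x\<bar> * (C * exp (\<epsilon> * norm (c x)))" for x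
      by (intro mult_left_mono) auto
    moreover have "0 \<le> C"
      using assms by (simp add: C_def)
    ultimately show "AE x in M. norm (w x * norm (c x) ^ k * exp (\<delta> * norm (c x)))
        \<le> norm (C * (w x * exp (\<epsilon> * norm (c x))))"
      by (simp add: abs_mult ac_simps)
  qed measurable
qed

text \<open>Integrability at the finitely many points \<open>\<theta> \<plusminus> s b\<close>, for \<open>b\<close> in the basis, suffices: the norm
  is at most the dimension times the largest absolute coordinate, so the exponential of a small
  multiple of the norm is at most one of the \<open>exp (\<plusminus> s (b \<bullet> c))\<close>.\<close>
lemma integrable_exp_norm:
  fixes c :: "'a \<Rightarrow> 'v::euclidean_space"
  assumes [measurable]: "c \<in> borel_measurable M"
    and "0 < r" and int: "\<And>\<xi>. \<xi> \<in> ball \<theta> r \<Longrightarrow> integrable M (\<lambda>x. exp (\<xi> \<bullet> c x))"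
  shows "\<exists>\<epsilon>>0. integrable M (\<lambda>x. exp (\<theta> \<bullet> c x) * exp (\<epsilon> * norm (c x)))"
proof (intro exI conjI)
  define s where "s = r / 2"
  define \<epsilon> where "\<epsilon> = s / DIM('v)"
  have s: "0 < s" "s < r" using \<open>0 < r\<close> by (auto simp: s_def)
  show "0 < \<epsilon>" using s by (simp add: \<epsilon>_def)
  show "integrable M (\<lambda>x. exp (\<theta> \<bullet> c x) * exp (\<epsilon> * norm (c x)))"
  proof (rule Bochner_Integration.integrable_bound)
    show "integrable M (\<lambda>x. \<Sum>b\<in>Basis. exp ((\<theta> + s *\<^sub>R b) \<bullet> c x) + exp ((\<theta> - s *\<^sub>R b) \<bullet> c x))"
      using s by (intro Bochner_Integration.integrable_sum Bochner_Integration.integrable_add int)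
        (auto simp: dist_norm)
    have "exp (\<theta> \<bullet> y) * exp (\<epsilon> * norm y)
        \<le> (\<Sum>b\<in>Basis. exp ((\<theta> + s *\<^sub>R b) \<bullet> y) + exp ((\<theta> - s *\<^sub>R b) \<bullet> y))" for y :: 'v
    proof -
      \<comment> \<open>the direction in which the coordinate of \<open>y\<close> is largest in absolute value\<close>
      obtain b where b: "b \<in> Basis" "\<And>b'. b' \<in> Basis \<Longrightarrow> \<bar>y \<bullet> b'\<bar> \<le> \<bar>y \<bullet> b\<bar>"
        using Max_in[of "(\<lambda>b. \<bar>y \<bullet> b\<bar>) ` Basis"] Max_ge[of "(\<lambda>b. \<bar>y \<bullet> b\<bar>) ` Basis"]
        by (fastforce simp: image_iff)
      have "norm y \<le> (\<Sum>b'\<in>Basis. \<bar>y \<bullet> b'\<bar>)"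
        by (rule norm_le_l1)
      also have "\<dots> \<le> DIM('v) * \<bar>y \<bullet> b\<bar>"
        using b(2) by (rule sum_bounded_above)
      finally have "\<epsilon> * norm y \<le> \<epsilon> * (DIM('v) * \<bar>y \<bullet> b\<bar>)"
        using \<open>0 < \<epsilon>\<close> by simp
      then have "\<epsilon> * norm y \<le> s * \<bar>y \<bullet> b\<bar>"
        by (simp add: \<epsilon>_def)
      then have "exp (\<theta> \<bullet> y) * exp (\<epsilon> * norm y) \<le> exp (\<theta> \<bullet> y + s * \<bar>y \<bullet> b\<bar>)"
        by (simp flip: exp_add)
      also have "\<dots> \<le> exp ((\<theta> + s *\<^sub>R b) \<bullet> y) + exp ((\<theta> - s *\<^sub>R b) \<bullet> y)"
        by (cases "0 \<le> y \<bullet> b") (auto simp: inner_add_left inner_diff_left inner_commute[of b])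
      also have "\<dots> \<le> (\<Sum>b\<in>Basis. exp ((\<theta> + s *\<^sub>R b) \<bullet> y) + exp ((\<theta> - s *\<^sub>R b) \<bullet> y))"
        by (rule member_le_sum[OF b(1)]) (auto intro: add_nonneg_nonneg)
      finally show ?thesis .
    qed
    then show "AE x in M. norm (exp (\<theta> \<bullet> c x) * exp (\<epsilon> * norm (c x))) \<le>
      norm (\<Sum>b\<in>Basis. exp ((\<theta> + s *\<^sub>R b) \<bullet> c x) + exp ((\<theta> - s *\<^sub>R b) \<bullet> c x))"
      by (intro AE_I2) (simp add: order_trans[OF _ abs_ge_self])
  qed measurable
qed

text \<open>Differentiation under the integral sign. The quadratic Taylor remainder of \<open>exp (h \<bullet> c)\<close> is at
  most \<open>|h|\<^sup>2 |c|\<^sup>2 exp (|h| |c|)\<close>, whose integral against the weight is at most \<open>K |h|\<^sup>2\<close> when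
  \<open>|h| \<le> \<epsilon> / 2\<close>; the other half of \<open>\<epsilon>\<close> is spent on \<open>|c|\<^sup>2\<close>.\<close>
lemma has_derivative_exp_integral:
  fixes c :: "'a \<Rightarrow> 'v::euclidean_space" and g :: "'a \<Rightarrow> real"
  assumes [measurable]: "c \<in> borel_measurable M" "g \<in> borel_measurable M"
    and \<epsilon>: "0 < \<epsilon>" and int: "integrable M (\<lambda>x. g x * exp (\<theta> \<bullet> c x) * exp (\<epsilon> * norm (c x)))"
  shows "((\<lambda>\<xi>. LINT x|M. g x * exp (\<xi> \<bullet> c x)) has_derivative
    (\<lambda>h. LINT x|M. g x * (h \<bullet> c x) * exp (\<theta> \<bullet> c x))) (at \<theta>)"
proof -
  define w where "w = (\<lambda>x. g x * exp (\<theta> \<bullet> c x))"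
  have [measurable]: "w \<in> borel_measurable M" by (simp add: w_def)
  have w: "integrable M (\<lambda>x. w x * norm (c x) ^ k * exp (\<delta> * norm (c x)))" if "\<delta> < \<epsilon>" for k \<delta>
    using that int by (intro integrable_norm_power_exp) (simp_all add: w_def)
  have w1: "integrable M (\<lambda>x. w x * (h \<bullet> c x))" for h
  proof (rule Bochner_Integration.integrable_bound)
    show "integrable M (\<lambda>x. norm h * (w x * norm (c x)))"
      using w[of 0 1] \<epsilon> by simp
    show "AE x in M. norm (w x * (h \<bullet> c x)) \<le> norm (norm h * (w x * norm (c x)))"
    proof (rule AE_I2)
      fix x
      have "\<bar>w x\<bar> * \<bar>h \<bullet> c x\<bar> \<le> \<bar>w x\<bar> * (norm h * norm (c x))"
        by (intro mult_left_mono Cauchy_Schwarz_ineq2) simp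
      then show "norm (w x * (h \<bullet> c x)) \<le> norm (norm h * (w x * norm (c x)))"
        by (simp add: abs_mult ac_simps)
    qed
  qed measurable
  define K where "K = (LINT x|M. \<bar>w x\<bar> * norm (c x) ^ 2 * exp (\<epsilon> / 2 * norm (c x)))"
  have intK: "integrable M (\<lambda>x. \<bar>w x\<bar> * norm (c x) ^ 2 * exp (\<epsilon> / 2 * norm (c x)))"
    using integrable_abs[OF w[of "\<epsilon> / 2" 2]] \<epsilon> by (simp add: abs_mult)
  have quad: "\<bar>(LINT x|M. g x * exp ((\<theta> + h) \<bullet> c x)) - (LINT x|M. g x * exp (\<theta> \<bullet> c x))
      - (LINT x|M. w x * (h \<bullet> c x))\<bar> \<le> K * (norm h)\<^sup>2" if h: "norm h \<le> \<epsilon> / 2" for h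
  proof -
    have rem: "\<bar>w x * (exp (h \<bullet> c x) - 1 - h \<bullet> c x)\<bar>
        \<le> (norm h)\<^sup>2 * (\<bar>w x\<bar> * norm (c x) ^ 2 * exp (\<epsilon> / 2 * norm (c x)))" for x
    proof -
      have u: "\<bar>h \<bullet> c x\<bar> \<le> norm h * norm (c x)" by (rule Cauchy_Schwarz_ineq2)
      also have "\<dots> \<le> \<epsilon> / 2 * norm (c x)" using h by (intro mult_right_mono) auto
      finally have u': "\<bar>h \<bullet> c x\<bar> \<le> \<epsilon> / 2 * norm (c x)" .
      have "\<bar>exp (h \<bullet> c x) - 1 - h \<bullet> c x\<bar> \<le> \<bar>h \<bullet> c x\<bar>\<^sup>2 * exp \<bar>h \<bullet> c x\<bar>"
        using exp_remainder_le[of "h \<bullet> c x"] by simp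
      also have "\<dots> \<le> (norm h * norm (c x))\<^sup>2 * exp (\<epsilon> / 2 * norm (c x))"
        using u u' by (intro mult_mono power_mono) auto
      finally have "\<bar>w x\<bar> * \<bar>exp (h \<bullet> c x) - 1 - h \<bullet> c x\<bar>
          \<le> \<bar>w x\<bar> * ((norm h * norm (c x))\<^sup>2 * exp (\<epsilon> / 2 * norm (c x)))"
        by (intro mult_left_mono) auto
      then show ?thesis by (simp add: abs_mult power_mult_distrib ac_simps)
    qed
    have intR: "integrable M (\<lambda>x. w x * (exp (h \<bullet> c x) - 1 - h \<bullet> c x))"
    proof (rule Bochner_Integration.integrable_bound[OF integrable_mult_right[OF intK, of "(norm h)\<^sup>2"]])
      show "AE x in M. norm (w x * (exp (h \<bullet> c x) - 1 - h \<bullet> c x))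
          \<le> norm ((norm h)\<^sup>2 * (\<bar>w x\<bar> * norm (c x) ^ 2 * exp (\<epsilon> / 2 * norm (c x))))"
        using rem by (intro AE_I2) (simp add: order_trans[OF _ abs_ge_self])
    qed measurable
    have w0: "integrable M w"
      using w[of 0 0] \<epsilon> by simp
    have "(LINT x|M. g x * exp ((\<theta> + h) \<bullet> c x))
      = (LINT x|M. w x * (exp (h \<bullet> c x) - 1 - h \<bullet> c x) + (w x + w x * (h \<bullet> c x)))"
      by (rule Bochner_Integration.integral_cong)
        (simp_all add: w_def algebra_simps inner_add_left exp_add)
    also have "\<dots> = (LINT x|M. w x * (exp (h \<bullet> c x) - 1 - h \<bullet> c x))
        + ((LINT x|M. w x) + (LINT x|M. w x * (h \<bullet> c x)))"
      using intR w0 w1 by simp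
    finally have "(LINT x|M. g x * exp ((\<theta> + h) \<bullet> c x)) - (LINT x|M. g x * exp (\<theta> \<bullet> c x))
      - (LINT x|M. w x * (h \<bullet> c x)) = (LINT x|M. w x * (exp (h \<bullet> c x) - 1 - h \<bullet> c x))"
      by (simp add: w_def)
    also have "\<bar>\<dots>\<bar> \<le> (LINT x|M. \<bar>w x * (exp (h \<bullet> c x) - 1 - h \<bullet> c x)\<bar>)"
      by (rule integral_abs_bound)
    also have "\<dots> \<le> (LINT x|M. (norm h)\<^sup>2 * (\<bar>w x\<bar> * norm (c x) ^ 2 * exp (\<epsilon> / 2 * norm (c x))))"
      by (intro integral_mono integrable_abs intR integrable_mult_right intK rem)
    also have "\<dots> = K * (norm h)\<^sup>2"
      by (simp add: K_def)
    finally show ?thesis .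
  qed
  have lin: "bounded_linear (\<lambda>h. LINT x|M. w x * (h \<bullet> c x))"
  proof -
    have "linear (\<lambda>h. LINT x|M. w x * (h \<bullet> c x))"
      using w1 by (intro linearI)
        (simp_all add: inner_add_left distrib_left mult.left_commute[of _ "_ :: real"])
    then show ?thesis by (rule linear_conv_bounded_linear[THEN iffD1])
  qed
  have "((\<lambda>h. norm ((LINT x|M. g x * exp ((\<theta> + h) \<bullet> c x)) - (LINT x|M. g x * exp (\<theta> \<bullet> c x))
      - (LINT x|M. w x * (h \<bullet> c x))) / norm h) \<longlongrightarrow> 0) (at 0)"
  proof (rule tendsto_sandwich[OF _ _ tendsto_const])
    show "((\<lambda>h. K * norm h) \<longlongrightarrow> 0) (at (0 :: 'v))"
      by (auto intro!: tendsto_eq_intros)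
    have "eventually (\<lambda>h::'v. h \<in> ball 0 (\<epsilon> / 2) \<and> h \<noteq> 0) (at 0)"
      using \<epsilon> by (auto simp: eventually_at dist_norm intro!: exI[of _ "\<epsilon> / 2"])
    then show "eventually (\<lambda>h. norm ((LINT x|M. g x * exp ((\<theta> + h) \<bullet> c x))
        - (LINT x|M. g x * exp (\<theta> \<bullet> c x)) - (LINT x|M. w x * (h \<bullet> c x))) / norm h \<le> K * norm h) (at 0)"
    proof eventually_elim
      case (elim h)
      then show ?case using quad[of h] by (simp add: divide_le_eq power2_eq_square mult.assoc)
    qed
  qed simp
  then have "((\<lambda>\<xi>. LINT x|M. g x * exp (\<xi> \<bullet> c x)) has_derivative
      (\<lambda>h. LINT x|M. w x * (h \<bullet> c x))) (at \<theta>)"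
    using lin by (simp add: has_derivative_at)
  then show ?thesis
    by (simp add: w_def ac_simps)
qed

text \<open>The same remainder estimate for the mean square error of a difference quotient. With
  \<open>h = \<phi> s - \<phi> t\<close> and \<open>d = h / (s - t)\<close> the error is, up to the factor \<open>exp (\<phi> t \<bullet> c / 2)\<close>, the
  sum of the Taylor remainder of \<open>exp (h \<bullet> c / 2)\<close> divided by \<open>s - t\<close>, which is of size
  \<open>|h| |d|\<close>, and of \<open>(d - \<phi>') \<bullet> c / 2\<close>. Along a curve \<open>d\<close> stays bounded, so both vanish in the
  limit. No normalizing factor occurs here: it is later made part of the curve.\<close>
lemma tendsto_L2_difference_quotient_exp:
  fixes c :: "'a \<Rightarrow> 'v::euclidean_space" and \<phi> :: "real \<Rightarrow> 'v"
  assumes [measurable]: "c \<in> borel_measurable M"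
    and \<epsilon>: "0 < \<epsilon>" and int: "integrable M (\<lambda>x. exp (\<phi> t \<bullet> c x) * exp (\<epsilon> * norm (c x)))"
    and \<phi>: "(\<phi> has_vector_derivative \<phi>') (at t within T)"
  shows "((\<lambda>s. LINT x|M. ((exp (\<phi> s \<bullet> c x / 2) - exp (\<phi> t \<bullet> c x / 2)) / (s - t)
      - (\<phi>' \<bullet> c x) / 2 * exp (\<phi> t \<bullet> c x / 2))\<^sup>2) \<longlongrightarrow> 0) (at t within T)"
proof -
  define w where "w = (\<lambda>x. exp (\<phi> t \<bullet> c x))"
  have [measurable]: "w \<in> borel_measurable M" by (simp add: w_def)
  have w: "integrable M (\<lambda>x. w x * norm (c x) ^ k * exp (\<delta> * norm (c x)))" if "\<delta> < \<epsilon>" for k \<delta>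
    using that int by (intro integrable_norm_power_exp) (simp_all add: w_def)
  have intA: "integrable M (\<lambda>x. w x * norm (c x) ^ 4 * exp (\<epsilon> / 2 * norm (c x)))"
    and intB: "integrable M (\<lambda>x. w x * norm (c x) ^ 2)"
    using w[of "\<epsilon> / 2" 4] w[of 0 2] \<epsilon> by simp_all
  define A where "A = (LINT x|M. w x * norm (c x) ^ 4 * exp (\<epsilon> / 2 * norm (c x)))"
  define B where "B = (LINT x|M. w x * norm (c x) ^ 2)"
  define h where "h = (\<lambda>s. \<phi> s - \<phi> t)"
  define d where "d s = h s /\<^sub>R (s - t)" for s
  define R where "R s x = (exp (\<phi> s \<bullet> c x / 2) - exp (\<phi> t \<bullet> c x / 2)) / (s - t)
      - (\<phi>' \<bullet> c x) / 2 * exp (\<phi> t \<bullet> c x / 2)" for s x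
  have "((\<lambda>s. norm (d s - \<phi>')) \<longlongrightarrow> 0) (at t within T)"
  proof (rule Lim_transform_eventually)
    show "((\<lambda>s. norm (\<phi> s - \<phi> t - (s - t) *\<^sub>R \<phi>') / norm (s - t)) \<longlongrightarrow> 0) (at t within T)"
      using \<phi> by (simp add: has_vector_derivative_def has_derivative_iff_norm)
    have "norm (\<phi> s - \<phi> t - (s - t) *\<^sub>R \<phi>') / norm (s - t) = norm (d s - \<phi>')" if "s \<noteq> t" for s
    proof -
      have "\<phi> s - \<phi> t - (s - t) *\<^sub>R \<phi>' = (s - t) *\<^sub>R (d s - \<phi>')"
        using that by (simp add: d_def h_def scaleR_diff_right)
      then show ?thesis using that by simp
    qed
    then show "\<forall>\<^sub>F s in at t within T. norm (\<phi> s - \<phi> t - (s - t) *\<^sub>R \<phi>') / norm (s - t) = norm (d s - \<phi>')"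
      by (auto simp: eventually_at intro: exI[of _ 1])
  qed
  then have d0: "((\<lambda>s. d s - \<phi>') \<longlongrightarrow> 0) (at t within T)"
    by (rule tendsto_norm_zero_cancel)
  then have d: "(d \<longlongrightarrow> \<phi>') (at t within T)"
    by (rule LIM_zero_cancel)
  have h: "(h \<longlongrightarrow> 0) (at t within T)"
    using has_vector_derivative_continuous[OF \<phi>]
    unfolding continuous_within h_def by (rule LIM_zero)
  have bound: "(R s x)\<^sup>2 \<le> 2 * ((norm (h s))\<^sup>2 * (norm (d s))\<^sup>2
        * (w x * norm (c x) ^ 4 * exp (\<epsilon> / 2 * norm (c x)))
      + (norm (d s - \<phi>'))\<^sup>2 * (w x * norm (c x) ^ 2))"
    if s: "s \<noteq> t" "norm (h s) \<le> \<epsilon> / 2" for s x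
  proof -
    define u where "u = (h s \<bullet> c x) / 2"
    define a where "a = (exp u - 1 - u) / (s - t)"
    define b where "b = ((d s - \<phi>') \<bullet> c x) / 2"
    have "u / (s - t) = (d s \<bullet> c x) / 2"
      by (simp add: u_def d_def inverse_eq_divide)
    then have b_eq: "b = u / (s - t) - (\<phi>' \<bullet> c x) / 2"
      by (simp add: b_def inner_diff_left diff_divide_distrib)
    have exp_s: "exp (\<phi> s \<bullet> c x / 2) = exp (\<phi> t \<bullet> c x / 2) * exp u"
    proof -
      have "\<phi> s \<bullet> c x / 2 = \<phi> t \<bullet> c x / 2 + u"
        by (simp add: u_def h_def inner_diff_left diff_divide_distrib)
      then show ?thesis by (simp only: exp_add)
    qed
    have "R s x = exp (\<phi> t \<bullet> c x / 2) * (a + b)"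
    proof -
      have "a + b = (exp u - 1) / (s - t) - (\<phi>' \<bullet> c x) / 2"
        by (simp add: a_def b_eq diff_divide_distrib)
      then show ?thesis
        by (simp add: R_def exp_s right_diff_distrib diff_divide_distrib)
    qed
    moreover have "(exp (\<phi> t \<bullet> c x / 2))\<^sup>2 = w x"
      using exp_double[of "\<phi> t \<bullet> c x / 2"] by (simp add: w_def)
    ultimately have "(R s x)\<^sup>2 = w x * (a + b)\<^sup>2"
      by (simp add: power_mult_distrib)
    also have "\<dots> \<le> w x * (2 * (a\<^sup>2 + b\<^sup>2))"
      using sum_squares_bound[of a b] by (intro mult_left_mono) (simp_all add: power2_sum w_def)
    also have "\<dots> \<le> w x * (2 * ((norm (h s))\<^sup>2 * (norm (d s))\<^sup>2 * (norm (c x) ^ 4 * exp (\<epsilon> / 2 * norm (c x)))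
        + (norm (d s - \<phi>'))\<^sup>2 * norm (c x) ^ 2))"
    proof (intro mult_left_mono add_mono)
      have u2: "2 * \<bar>u\<bar> \<le> norm (h s) * norm (c x)"
        using Cauchy_Schwarz_ineq2[of "h s" "c x"] by (simp add: u_def)
      then have u: "\<bar>u\<bar> \<le> norm (h s) * norm (c x)"
        by simp
      have "norm (h s) * norm (c x) \<le> \<epsilon> / 2 * norm (c x)"
        using s(2) by (intro mult_right_mono) auto
      then have u': "2 * \<bar>u\<bar> \<le> \<epsilon> / 2 * norm (c x)"
        using u2 by simp
      have "\<bar>exp u - 1 - u\<bar> \<le> u\<^sup>2 * exp \<bar>u\<bar>"
        by (rule exp_remainder_le)
      then have "(exp u - 1 - u)\<^sup>2 \<le> (u\<^sup>2 * exp \<bar>u\<bar>)\<^sup>2"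
        by (metis abs_ge_zero power2_abs power_mono)
      also have "\<dots> = \<bar>u\<bar> ^ 4 * exp (2 * \<bar>u\<bar>)"
        by (simp add: power_mult_distrib exp_double)
      also have "\<dots> \<le> (norm (h s) * norm (c x)) ^ 4 * exp (\<epsilon> / 2 * norm (c x))"
        using u u' by (intro mult_mono power_mono) auto
      finally have "a\<^sup>2 \<le> (norm (h s) * norm (c x)) ^ 4 * exp (\<epsilon> / 2 * norm (c x)) / (s - t)\<^sup>2"
        unfolding a_def power_divide by (rule divide_right_mono) simp
      also have "\<dots> = (norm (h s))\<^sup>2 * (norm (h s) / \<bar>s - t\<bar>)\<^sup>2 * (norm (c x) ^ 4 * exp (\<epsilon> / 2 * norm (c x)))"
        by (simp add: power_mult_distrib power_divide power4_eq_xxxx power2_eq_square)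
      also have "norm (h s) / \<bar>s - t\<bar> = norm (d s)"
        by (simp add: d_def inverse_eq_divide)
      finally show "a\<^sup>2 \<le> (norm (h s))\<^sup>2 * (norm (d s))\<^sup>2 * (norm (c x) ^ 4 * exp (\<epsilon> / 2 * norm (c x)))" .
      have b_le: "\<bar>b\<bar> \<le> norm (d s - \<phi>') * norm (c x)"
        using Cauchy_Schwarz_ineq2[of "d s - \<phi>'" "c x"] unfolding b_def by simp
      show "b\<^sup>2 \<le> (norm (d s - \<phi>'))\<^sup>2 * norm (c x) ^ 2"
        using power_mono[OF b_le abs_ge_zero, of 2] by (simp add: power_mult_distrib)
    qed (simp_all add: w_def)
    finally show ?thesis
      by (simp add: distrib_left ac_simps)
  qed
  have "((\<lambda>s. LINT x|M. (R s x)\<^sup>2) \<longlongrightarrow> 0) (at t within T)"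
  proof (rule tendsto_sandwich[OF _ _ tendsto_const])
    show "((\<lambda>s. 2 * ((norm (h s))\<^sup>2 * (norm (d s))\<^sup>2 * A + (norm (d s - \<phi>'))\<^sup>2 * B)) \<longlongrightarrow> 0) (at t within T)"
    proof -
      have "((\<lambda>s. 2 * ((norm (h s))\<^sup>2 * (norm (d s))\<^sup>2 * A + (norm (d s - \<phi>'))\<^sup>2 * B))
          \<longlongrightarrow> 2 * ((norm (0 :: 'v))\<^sup>2 * (norm \<phi>')\<^sup>2 * A + (norm (0 :: 'v))\<^sup>2 * B)) (at t within T)"
        by (intro tendsto_mult tendsto_add tendsto_power tendsto_norm tendsto_const h d d0)
      then show ?thesis by simp
    qed
    have "\<forall>\<^sub>F s in at t within T. norm (h s) < \<epsilon> / 2"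
      using tendstoD[OF h, of "\<epsilon> / 2"] \<epsilon> by simp
    moreover have "\<forall>\<^sub>F s in at t within T. s \<noteq> t"
      by (auto simp: eventually_at intro: exI[of _ 1])
    ultimately show "\<forall>\<^sub>F s in at t within T. (LINT x|M. (R s x)\<^sup>2)
        \<le> 2 * ((norm (h s))\<^sup>2 * (norm (d s))\<^sup>2 * A + (norm (d s - \<phi>'))\<^sup>2 * B)"
    proof eventually_elim
      case (elim s)
      have "(LINT x|M. (R s x)\<^sup>2) \<le> (LINT x|M. 2 * ((norm (h s))\<^sup>2 * (norm (d s))\<^sup>2
          * (w x * norm (c x) ^ 4 * exp (\<epsilon> / 2 * norm (c x)))
          + (norm (d s - \<phi>'))\<^sup>2 * (w x * norm (c x) ^ 2)))"
      proof (rule integral_mono')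
        show "integrable M (\<lambda>x. 2 * ((norm (h s))\<^sup>2 * (norm (d s))\<^sup>2
            * (w x * norm (c x) ^ 4 * exp (\<epsilon> / 2 * norm (c x)))
            + (norm (d s - \<phi>'))\<^sup>2 * (w x * norm (c x) ^ 2)))"
          by (intro integrable_mult_right Bochner_Integration.integrable_add intA intB)
      qed (use elim bound[of s] in \<open>simp_all add: w_def\<close>)
      then show ?case
        using intA intB by (simp add: A_def B_def)
    qed
  qed simp
  then show ?thesis by (simp add: R_def)
qed

section \<open>Partial derivatives, constants and positive definite matrices\<close>

lemma partial_deriv_eq:
  assumes "(\<phi> has_derivative D) (at x)"
  shows "partial_deriv i \<phi> x = D (axis i 1)"
proof -
  interpret D: bounded_linear D
    using assms by (rule has_derivative_bounded_linear)
  have "((\<lambda>h. \<phi> (x + h *\<^sub>R axis i 1)) has_derivative (\<lambda>h. D (h *\<^sub>R axis i 1))) (at 0)"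
    by (rule has_derivative_compose[where s = UNIV]) (auto intro!: derivative_eq_intros assms)
  moreover have "(\<lambda>h. D (h *\<^sub>R axis i 1)) = (*) (D (axis i 1))"
    by (simp add: fun_eq_iff D.scaleR)
  ultimately have "((\<lambda>h. \<phi> (x + h *\<^sub>R axis i 1)) has_real_derivative D (axis i 1)) (at 0)"
    by (simp add: has_field_derivative_def)
  then show ?thesis
    by (simp add: partial_deriv_def DERIV_imp_deriv)
qed

lemma partial_deriv_const: "partial_deriv i (\<lambda>x. a) = (\<lambda>x. 0)"
  by (simp add: partial_deriv_def fun_eq_iff)

lemma FPK_adjoint_one: "FPK_adjoint f \<sigma> t (\<lambda>x. 1) x = 0"
  by (simp add: FPK_adjoint_def partial_deriv_const)

lemma pos_definite_matrix_inv:
  assumes "pos_definite A"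
  shows "matrix_inv A *v (A *v v) = v" "A *v (matrix_inv A *v v) = v"
proof -
  have "\<forall>x. A *v x = 0 \<longrightarrow> x = 0"
    using assms unfolding pos_definite_def by (metis inner_zero_right less_irrefl)
  then have "invertible A"
    unfolding invertible_left_inverse by (simp only: matrix_left_invertible_ker)
  then have "matrix_inv A ** A = mat 1" "A ** matrix_inv A = mat 1"
    unfolding matrix_inv_def invertible_def by (metis (mono_tags, lifting) someI_ex)+
  then show "matrix_inv A *v (A *v v) = v" "A *v (matrix_inv A *v v) = v"
    by (simp_all add: matrix_vector_mul_assoc)
qed

section \<open>Uniqueness of derivatives of curves of square integrable functions\<close>

lemma L2_norm_square: "(L2_norm u)\<^sup>2 = (LINT x|lborel. (u x)\<^sup>2)"
  by (simp add: L2_norm_def L2_inner_def flip: power2_eq_square)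

lemma L2_fun_diff:
  assumes "L2_fun u" "L2_fun v"
  shows "L2_fun (\<lambda>x. u x - v x)"
    and "(L2_norm (\<lambda>x. u x - v x))\<^sup>2 \<le> 2 * (L2_norm u)\<^sup>2 + 2 * (L2_norm v)\<^sup>2"
proof -
  have [measurable]: "u \<in> borel_measurable lborel" "v \<in> borel_measurable lborel"
    and int: "integrable lborel (\<lambda>x. 2 * (u x)\<^sup>2 + 2 * (v x)\<^sup>2)"
    using assms by (simp_all add: L2_fun_def)
  have le: "(u x - v x)\<^sup>2 \<le> 2 * (u x)\<^sup>2 + 2 * (v x)\<^sup>2" for x
    using sum_squares_bound[of "u x" "- v x"] by (simp add: power2_diff)
  have "integrable lborel (\<lambda>x. (u x - v x)\<^sup>2)"
    by (rule Bochner_Integration.integrable_bound[OF int]) (use le in auto)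
  then show "L2_fun (\<lambda>x. u x - v x)"
    by (simp add: L2_fun_def)
  have "(LINT x|lborel. (u x - v x)\<^sup>2) \<le> (LINT x|lborel. 2 * (u x)\<^sup>2 + 2 * (v x)\<^sup>2)"
    by (rule integral_mono) (use \<open>integrable lborel (\<lambda>x. (u x - v x)\<^sup>2)\<close> int le in auto)
  then show "(L2_norm (\<lambda>x. u x - v x))\<^sup>2 \<le> 2 * (L2_norm u)\<^sup>2 + 2 * (L2_norm v)\<^sup>2"
    using assms by (simp add: L2_norm_square L2_fun_def)
qed

lemma L2_fun_divide:
  assumes "L2_fun u"
  shows "L2_fun (\<lambda>x. u x / a)"
  using assms by (auto simp: L2_fun_def power_divide)

text \<open>Derivatives in \<open>L\<^sup>2\<close> are determined only up to null sets, hence the form of the conclusion.\<close>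
lemma has_L2_derivative_unique:
  assumes "has_L2_derivative F V t T" "has_L2_derivative F V' t T"
    and "t \<in> T" and nontriv: "at t within T \<noteq> bot"
  shows "(LINT x|lborel. (V x - V' x)\<^sup>2) = 0"
proof -
  define q where "q s x = (F s x - F t x) / (s - t)" for s x
  have F: "\<And>s. s \<in> T \<Longrightarrow> L2_fun (F s)" and V: "L2_fun V" "L2_fun V'"
    and lim: "((\<lambda>s. L2_norm (\<lambda>x. q s x - V x)) \<longlongrightarrow> 0) (at t within T)"
      "((\<lambda>s. L2_norm (\<lambda>x. q s x - V' x)) \<longlongrightarrow> 0) (at t within T)"
    using assms by (auto simp: has_L2_derivative_def q_def)
  have q: "L2_fun (q s)" if "s \<in> T" for s
    unfolding q_def[abs_def] using F that \<open>t \<in> T\<close> by (intro L2_fun_divide L2_fun_diff)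
  have "(LINT x|lborel. (V x - V' x)\<^sup>2) \<le> 0"
  proof (rule tendsto_lowerbound[OF _ _ nontriv])
    show "((\<lambda>s. 2 * (L2_norm (\<lambda>x. q s x - V' x))\<^sup>2 + 2 * (L2_norm (\<lambda>x. q s x - V x))\<^sup>2) \<longlongrightarrow> 0) (at t within T)"
      using lim by (auto intro!: tendsto_eq_intros)
    have "\<forall>\<^sub>F s in at t within T. s \<in> T"
      by (auto simp: eventually_at intro: exI[of _ 1])
    then show "\<forall>\<^sub>F s in at t within T. (LINT x|lborel. (V x - V' x)\<^sup>2)
        \<le> 2 * (L2_norm (\<lambda>x. q s x - V' x))\<^sup>2 + 2 * (L2_norm (\<lambda>x. q s x - V x))\<^sup>2"
    proof eventually_elim
      case (elim s)
      have "L2_fun (\<lambda>x. q s x - V' x)" "L2_fun (\<lambda>x. q s x - V x)"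
        using q[OF elim] V by (auto intro: L2_fun_diff)
      from L2_fun_diff(2)[OF this] show ?case
        by (simp flip: L2_norm_square)
    qed
  qed
  then show ?thesis
    by (simp add: order_antisym)
qed

section \<open>Expectation parameters and Fisher matrix as derivatives\<close>

lemma ef_density_pos: "0 < ef_density c \<theta> x"
  by (simp add: ef_density_def)

locale exp_family =
  fixes c :: "real ^ 'N \<Rightarrow> real ^ 'n" and \<Theta> :: "(real ^ 'n) set"
  assumes family: "exponential_family c \<Theta>"
begin

abbreviation p where "p \<equiv> ef_density c"
abbreviation \<psi> where "\<psi> \<equiv> log_partition c"
abbreviation \<eta> where "\<eta> \<equiv> expectation_param c"
abbreviation F where "F \<equiv> fisher_matrix c"

lemma open_param: "open \<Theta>"
  using family by (simp add: exponential_family_def)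

lemma has_integral_density: "\<theta> \<in> \<Theta> \<Longrightarrow> has_bochner_integral lborel (p \<theta>) 1"
  using family by (simp add: exponential_family_def probability_density_def)

lemma integrable_density: "\<theta> \<in> \<Theta> \<Longrightarrow> integrable lborel (p \<theta>)"
  and integral_density: "\<theta> \<in> \<Theta> \<Longrightarrow> integral\<^sup>L lborel (p \<theta>) = 1"
  using has_integral_density by (auto simp: has_bochner_integral_iff)

lemma density_eq: "p \<theta> x = exp (- \<psi> \<theta>) * exp (\<theta> \<bullet> c x)"
  by (simp add: ef_density_def flip: exp_add)

lemma exp_eq_density: "exp (\<theta> \<bullet> c x) = exp (\<psi> \<theta>) * p \<theta> x"
  by (simp add: ef_density_def flip: exp_add)

lemma integral_mult_exp: "(LINT x|lborel. g x * exp (\<theta> \<bullet> c x)) = exp (\<psi> \<theta>) * (LINT x|lborel. p \<theta> x * g x)"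
proof -
  have "(LINT x|lborel. g x * exp (\<theta> \<bullet> c x)) = (LINT x|lborel. exp (\<psi> \<theta>) * (p \<theta> x * g x))"
    by (rule Bochner_Integration.integral_cong) (simp_all add: exp_eq_density)
  then show ?thesis by simp
qed

lemma integrable_exp: "\<theta> \<in> \<Theta> \<Longrightarrow> integrable lborel (\<lambda>x. exp (\<theta> \<bullet> c x))"
  using integrable_density by (simp add: exp_eq_density)

lemma integral_exp: "\<theta> \<in> \<Theta> \<Longrightarrow> (LINT x|lborel. exp (\<theta> \<bullet> c x)) = exp (\<psi> \<theta>)"
  using integral_density by (simp add: exp_eq_density)

text \<open>Measurability of \<open>c\<close> is implicit in that of the densities: \<open>\<xi> \<bullet> c\<close> is the logarithm of an
  integrable function for \<open>\<xi>\<close> near \<open>\<theta>\<close>, and a coordinate of \<open>c\<close> is a difference quotient of these.\<close>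
lemma measurable_statistic:
  assumes "\<theta> \<in> \<Theta>"
  shows "c \<in> borel_measurable borel"
proof -
  obtain r where r: "0 < r" "ball \<theta> r \<subseteq> \<Theta>"
    using open_param assms open_contains_ball by blast
  have meas: "(\<lambda>x. \<xi> \<bullet> c x) \<in> borel_measurable borel" if "\<xi> \<in> \<Theta>" for \<xi>
  proof -
    have "(\<lambda>x. ln (exp (\<xi> \<bullet> c x))) \<in> borel_measurable lborel"
      using integrable_exp[OF that, THEN borel_measurable_integrable] by measurable
    then show ?thesis by simp
  qed
  have "(\<lambda>x. c x \<bullet> b) \<in> borel_measurable borel" if "b \<in> Basis" for b
  proof -
    have "(\<lambda>x. ((\<theta> + (r / 2) *\<^sub>R b) \<bullet> c x - \<theta> \<bullet> c x) / (r / 2)) \<in> borel_measurable borel"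
      using assms r that
      by (intro borel_measurable_divide borel_measurable_diff meas) (auto simp: dist_norm)
    then show ?thesis
      using r by (simp add: inner_add_left inner_commute[of b])
  qed
  then show ?thesis
    using borel_measurable_euclidean_space by blast
qed

lemma integrable_exp_norm_statistic:
  assumes "\<theta> \<in> \<Theta>"
  obtains \<epsilon> where "0 < \<epsilon>" "integrable lborel (\<lambda>x. exp (\<theta> \<bullet> c x) * exp (\<epsilon> * norm (c x)))"
proof -
  obtain r where r: "0 < r" "ball \<theta> r \<subseteq> \<Theta>"
    using open_param assms open_contains_ball by blast
  have "\<exists>\<epsilon>>0. integrable lborel (\<lambda>x. exp (\<theta> \<bullet> c x) * exp (\<epsilon> * norm (c x)))"
    using measurable_statistic[OF assms] r by (intro integrable_exp_norm integrable_exp) auto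
  then show ?thesis
    using that by blast
qed

lemma integrable_density_norm_power:
  assumes "\<theta> \<in> \<Theta>"
  shows "integrable lborel (\<lambda>x. p \<theta> x * norm (c x) ^ k)"
proof -
  note [measurable] = measurable_statistic[OF assms]
  obtain \<epsilon> where "0 < \<epsilon>" "integrable lborel (\<lambda>x. exp (\<theta> \<bullet> c x) * exp (\<epsilon> * norm (c x)))"
    using integrable_exp_norm_statistic[OF assms] .
  then have "integrable lborel (\<lambda>x. exp (\<theta> \<bullet> c x) * norm (c x) ^ k)"
    using integrable_norm_power_exp[of c lborel "\<lambda>x. exp (\<theta> \<bullet> c x)" \<epsilon> 0 k] by simp
  then show ?thesis
    by (simp add: density_eq mult.assoc)
qed

lemma integrable_density_mult:
  assumes "\<theta> \<in> \<Theta>" and [measurable]: "g \<in> borel_measurable borel"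
    and bound: "\<And>x. \<bar>g x\<bar> \<le> C * norm (c x) ^ k"
  shows "integrable lborel (\<lambda>x. p \<theta> x * g x)"
proof (rule Bochner_Integration.integrable_bound)
  note [measurable] = measurable_statistic[OF assms(1)]
  show "integrable lborel (\<lambda>x. C * (p \<theta> x * norm (c x) ^ k))"
    by (intro integrable_mult_right integrable_density_norm_power assms)
  have "norm (p \<theta> x * g x) \<le> norm (C * (p \<theta> x * norm (c x) ^ k))" for x
  proof -
    have "p \<theta> x * \<bar>g x\<bar> \<le> p \<theta> x * (C * norm (c x) ^ k)"
      by (intro mult_left_mono bound) (simp add: ef_density_pos less_imp_le)
    also have "\<dots> \<le> \<bar>C * (p \<theta> x * norm (c x) ^ k)\<bar>"
      by (simp add: mult.left_commute)
    finally show ?thesis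
      using ef_density_pos[of c \<theta> x] by (simp add: abs_mult)
  qed
  then show "AE x in lborel. norm (p \<theta> x * g x) \<le> norm (C * (p \<theta> x * norm (c x) ^ k))"
    by simp
  show "(\<lambda>x. p \<theta> x * g x) \<in> borel_measurable lborel"
    unfolding ef_density_def by measurable
qed

lemma integrable_density_inner:
  assumes "\<theta> \<in> \<Theta>"
  shows "integrable lborel (\<lambda>x. p \<theta> x * (v \<bullet> c x))"
  using measurable_statistic[OF assms] Cauchy_Schwarz_ineq2[of v]
  by (intro integrable_density_mult[OF assms, where C = "norm v" and k = 1]) auto

lemma integrable_density_inner_inner:
  assumes "\<theta> \<in> \<Theta>"
  shows "integrable lborel (\<lambda>x. p \<theta> x * ((v \<bullet> c x) * (w \<bullet> c x)))"
proof (rule integrable_density_mult[OF assms])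
  fix x
  have "\<bar>v \<bullet> c x\<bar> * \<bar>w \<bullet> c x\<bar> \<le> (norm v * norm (c x)) * (norm w * norm (c x))"
    by (intro mult_mono Cauchy_Schwarz_ineq2) auto
  then show "\<bar>(v \<bullet> c x) * (w \<bullet> c x)\<bar> \<le> (norm v * norm w) * norm (c x) ^ 2"
    by (simp add: abs_mult power2_eq_square ac_simps)
qed (use measurable_statistic[OF assms] in auto)

lemma inner_expectation_param:
  assumes "\<theta> \<in> \<Theta>"
  shows "v \<bullet> \<eta> \<theta> = (LINT x|lborel. p \<theta> x * (v \<bullet> c x))"
proof -
  note [measurable] = measurable_statistic[OF assms]
  have "integrable lborel (\<lambda>x. p \<theta> x *\<^sub>R c x)"
  proof (rule Bochner_Integration.integrable_bound)
    show "integrable lborel (\<lambda>x. p \<theta> x * norm (c x) ^ 1)"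
      by (rule integrable_density_norm_power[OF assms])
    show "(\<lambda>x. p \<theta> x *\<^sub>R c x) \<in> borel_measurable lborel"
      unfolding ef_density_def by measurable
  qed simp
  then show ?thesis
    by (simp add: expectation_param_def expect_def flip: integral_inner_right)
qed

lemma log_partition_has_derivative:
  assumes "\<theta> \<in> \<Theta>"
  shows "(\<psi> has_derivative (\<lambda>h. h \<bullet> \<eta> \<theta>)) (at \<theta>)"
proof -
  note [measurable] = measurable_statistic[OF assms]
  obtain \<epsilon> where "0 < \<epsilon>" "integrable lborel (\<lambda>x. exp (\<theta> \<bullet> c x) * exp (\<epsilon> * norm (c x)))"
    using integrable_exp_norm_statistic[OF assms] .
  then have "((\<lambda>\<xi>. LINT x|lborel. exp (\<xi> \<bullet> c x)) has_derivative
      (\<lambda>h. LINT x|lborel. (h \<bullet> c x) * exp (\<theta> \<bullet> c x))) (at \<theta>)"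
    using has_derivative_exp_integral[of c lborel "\<lambda>_. 1" \<epsilon> \<theta>] by simp
  then have "((\<lambda>\<xi>. ln (LINT x|lborel. exp (\<xi> \<bullet> c x))) has_derivative
      (\<lambda>h. (LINT x|lborel. (h \<bullet> c x) * exp (\<theta> \<bullet> c x)) * inverse (LINT x|lborel. exp (\<theta> \<bullet> c x)))) (at \<theta>)"
    by (intro has_derivative_ln) (simp_all add: integral_exp assms)
  moreover have "(LINT x|lborel. (h \<bullet> c x) * exp (\<theta> \<bullet> c x)) * inverse (LINT x|lborel. exp (\<theta> \<bullet> c x))
      = h \<bullet> \<eta> \<theta>" for h
    by (simp add: integral_exp[OF assms] inner_expectation_param[OF assms] integral_mult_exp)
  ultimately show ?thesis
    by (simp add: log_partition_def[abs_def])
qed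

text \<open>The mean of \<open>v \<bullet> c\<close> is \<open>exp (- \<psi>)\<close> times an exponential integral with weight \<open>v \<bullet> c\<close>; the
  product rule produces the covariance of \<open>v \<bullet> c\<close> and \<open>h \<bullet> c\<close>.\<close>
lemma inner_expectation_param_has_derivative:
  assumes "\<theta> \<in> \<Theta>"
  shows "((\<lambda>\<xi>. v \<bullet> \<eta> \<xi>) has_derivative
    (\<lambda>h. (LINT x|lborel. p \<theta> x * ((v \<bullet> c x) * (h \<bullet> c x))) - (v \<bullet> \<eta> \<theta>) * (h \<bullet> \<eta> \<theta>))) (at \<theta>)"
proof -
  note [measurable] = measurable_statistic[OF assms]
  obtain \<epsilon> where \<epsilon>: "0 < \<epsilon>" "integrable lborel (\<lambda>x. exp (\<theta> \<bullet> c x) * exp (\<epsilon> * norm (c x)))"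
    using integrable_exp_norm_statistic[OF assms] .
  define N where "N \<xi> = (LINT x|lborel. (v \<bullet> c x) * exp (\<xi> \<bullet> c x))" for \<xi>
  have "integrable lborel (\<lambda>x. (v \<bullet> c x) * exp (\<theta> \<bullet> c x) * exp (\<epsilon> / 2 * norm (c x)))"
  proof (rule Bochner_Integration.integrable_bound)
    show "integrable lborel (\<lambda>x. norm v * (exp (\<theta> \<bullet> c x) * norm (c x) ^ 1 * exp (\<epsilon> / 2 * norm (c x))))"
      using \<epsilon> by (intro integrable_mult_right integrable_norm_power_exp[where \<epsilon> = \<epsilon>]) auto
    have "exp (\<theta> \<bullet> c x) * exp (\<epsilon> / 2 * norm (c x)) * \<bar>v \<bullet> c x\<bar>
        \<le> exp (\<theta> \<bullet> c x) * exp (\<epsilon> / 2 * norm (c x)) * (norm v * norm (c x))" for x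
      by (intro mult_left_mono Cauchy_Schwarz_ineq2) simp
    then show "AE x in lborel. norm ((v \<bullet> c x) * exp (\<theta> \<bullet> c x) * exp (\<epsilon> / 2 * norm (c x)))
        \<le> norm (norm v * (exp (\<theta> \<bullet> c x) * norm (c x) ^ 1 * exp (\<epsilon> / 2 * norm (c x))))"
      by (simp add: abs_mult ac_simps)
  qed measurable
  then have N: "(N has_derivative (\<lambda>h. LINT x|lborel. (v \<bullet> c x) * (h \<bullet> c x) * exp (\<theta> \<bullet> c x))) (at \<theta>)"
    unfolding N_def[abs_def]
    by (intro has_derivative_exp_integral[where \<epsilon> = "\<epsilon> / 2"]) (use \<epsilon> in auto)
  have eq: "v \<bullet> \<eta> \<xi> = exp (- \<psi> \<xi>) * N \<xi>" if "\<xi> \<in> \<Theta>" for \<xi>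
    by (simp add: inner_expectation_param[OF that] N_def integral_mult_exp exp_minus)
  have "((\<lambda>\<xi>. exp (- \<psi> \<xi>) * N \<xi>) has_derivative (\<lambda>h.
      exp (- \<psi> \<theta>) * (LINT x|lborel. (v \<bullet> c x) * (h \<bullet> c x) * exp (\<theta> \<bullet> c x))
      + - (h \<bullet> \<eta> \<theta>) * exp (- \<psi> \<theta>) * N \<theta>)) (at \<theta>)"
    by (intro derivative_intros has_derivative_exp log_partition_has_derivative assms N)
  moreover have "exp (- \<psi> \<theta>) * (LINT x|lborel. (v \<bullet> c x) * (h \<bullet> c x) * exp (\<theta> \<bullet> c x))
      + - (h \<bullet> \<eta> \<theta>) * exp (- \<psi> \<theta>) * N \<theta>
      = (LINT x|lborel. p \<theta> x * ((v \<bullet> c x) * (h \<bullet> c x))) - (v \<bullet> \<eta> \<theta>) * (h \<bullet> \<eta> \<theta>)" for h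
    unfolding eq[OF assms] integral_mult_exp by (simp add: exp_minus)
  ultimately have "((\<lambda>\<xi>. exp (- \<psi> \<xi>) * N \<xi>) has_derivative
    (\<lambda>h. (LINT x|lborel. p \<theta> x * ((v \<bullet> c x) * (h \<bullet> c x))) - (v \<bullet> \<eta> \<theta>) * (h \<bullet> \<eta> \<theta>))) (at \<theta>)"
    by simp
  then show ?thesis
    by (rule has_derivative_transform_within_open[OF _ open_param assms]) (simp add: eq)
qed

text \<open>The Fisher matrix is the covariance matrix of \<open>c\<close>. Its definition by iterated coordinatewise
  derivatives of \<open>\<psi>\<close> is evaluated by differentiating the gradient \<open>\<eta>\<close>, which is available on a
  whole neighbourhood of \<open>\<theta>\<close>. In the form of a bilinear form it serves both as the derivative of
  \<open>\<eta>\<close> and as the Gram matrix of the tangent vectors.\<close>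
lemma inner_fisher_matrix:
  assumes "\<theta> \<in> \<Theta>"
  shows "v \<bullet> (F \<theta> *v w)
    = (LINT x|lborel. p \<theta> x * ((v \<bullet> c x) * (w \<bullet> c x))) - (v \<bullet> \<eta> \<theta>) * (w \<bullet> \<eta> \<theta>)"
proof -
  define e :: "'n \<Rightarrow> real ^ 'n" where "e = (\<lambda>i. axis i 1)"
  have grad: "partial_deriv j \<psi> \<xi> = e j \<bullet> \<eta> \<xi>" if "\<xi> \<in> \<Theta>" for j \<xi>
    unfolding e_def by (rule partial_deriv_eq[OF log_partition_has_derivative[OF that]])
  have F: "F \<theta> $ i $ j = (LINT x|lborel. p \<theta> x * ((e i \<bullet> c x) * (e j \<bullet> c x)))
      - (e i \<bullet> \<eta> \<theta>) * (e j \<bullet> \<eta> \<theta>)" for i j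
  proof -
    have "(partial_deriv j \<psi> has_derivative (\<lambda>h. (LINT x|lborel. p \<theta> x * ((e j \<bullet> c x) * (h \<bullet> c x)))
        - (e j \<bullet> \<eta> \<theta>) * (h \<bullet> \<eta> \<theta>))) (at \<theta>)"
      by (rule has_derivative_transform_within_open[OF
            inner_expectation_param_has_derivative[OF assms] open_param assms]) (simp add: grad)
    then show ?thesis
      by (simp add: fisher_matrix_def partial_deriv_eq e_def ac_simps)
  qed
  have expand: "v \<bullet> y = (\<Sum>i\<in>UNIV. v $ i * (e i \<bullet> y))" for v y :: "real ^ 'n"
    by (simp add: e_def inner_axis') (simp add: inner_vec_def)
  have "v \<bullet> (F \<theta> *v w) = (\<Sum>i\<in>UNIV. \<Sum>j\<in>UNIV. v $ i * w $ j * F \<theta> $ i $ j)"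
    by (simp add: inner_vec_def matrix_vector_mult_def sum_distrib_left ac_simps)
  also have "\<dots> = (\<Sum>i\<in>UNIV. \<Sum>j\<in>UNIV. LINT x|lborel. v $ i * w $ j * (p \<theta> x * ((e i \<bullet> c x) * (e j \<bullet> c x))))
      - (\<Sum>i\<in>UNIV. \<Sum>j\<in>UNIV. v $ i * w $ j * ((e i \<bullet> \<eta> \<theta>) * (e j \<bullet> \<eta> \<theta>)))"
    by (simp add: F right_diff_distrib sum_subtractf)
  also have "(\<Sum>i\<in>UNIV. \<Sum>j\<in>UNIV. v $ i * w $ j * ((e i \<bullet> \<eta> \<theta>) * (e j \<bullet> \<eta> \<theta>)))
      = (v \<bullet> \<eta> \<theta>) * (w \<bullet> \<eta> \<theta>)"
    unfolding expand[of v] expand[of w] by (simp add: sum_product ac_simps)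
  also have "(\<Sum>i\<in>UNIV. \<Sum>j\<in>UNIV. LINT x|lborel. v $ i * w $ j * (p \<theta> x * ((e i \<bullet> c x) * (e j \<bullet> c x))))
      = (LINT x|lborel. (\<Sum>i\<in>UNIV. \<Sum>j\<in>UNIV. v $ i * w $ j * (p \<theta> x * ((e i \<bullet> c x) * (e j \<bullet> c x)))))"
    using integrable_density_inner_inner[OF assms]
    by (simp add: Bochner_Integration.integral_sum Bochner_Integration.integrable_sum)
  also have "\<dots> = (LINT x|lborel. p \<theta> x * ((v \<bullet> c x) * (w \<bullet> c x)))"
  proof (rule Bochner_Integration.integral_cong[OF refl])
    fix x
    show "(\<Sum>i\<in>UNIV. \<Sum>j\<in>UNIV. v $ i * w $ j * (p \<theta> x * ((e i \<bullet> c x) * (e j \<bullet> c x))))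
        = p \<theta> x * ((v \<bullet> c x) * (w \<bullet> c x))"
      unfolding expand[of v "c x"] expand[of w "c x"] sum_product
      unfolding sum_distrib_left by (simp add: ac_simps)
  qed
  finally show ?thesis .
qed

lemma expectation_param_has_derivative:
  assumes "\<theta> \<in> \<Theta>"
  shows "(\<eta> has_derivative (\<lambda>h. F \<theta> *v h)) (at \<theta>)"
proof (rule has_derivative_componentwise_within[THEN iffD2], rule ballI)
  fix b :: "real ^ 'n"
  show "((\<lambda>\<xi>. \<eta> \<xi> \<bullet> b) has_derivative (\<lambda>h. (F \<theta> *v h) \<bullet> b)) (at \<theta>)"
    using inner_expectation_param_has_derivative[OF assms, of b]
    unfolding inner_fisher_matrix[OF assms, symmetric] by (subst (1 2) inner_commute)
qed

lemma sqrt_tangent_eq: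
  assumes "\<theta> \<in> \<Theta>"
  shows "sqrt_tangent c \<theta> i x = sqrt (p \<theta> x) / 2 * (c x $ i - \<eta> \<theta> $ i)"
proof -
  have "((\<lambda>\<xi>. p \<xi> x) has_derivative (\<lambda>h. (h \<bullet> c x - h \<bullet> \<eta> \<theta>) * p \<theta> x)) (at \<theta>)"
    unfolding ef_density_def
    by (intro has_derivative_exp has_derivative_diff has_derivative_inner_left
        has_derivative_ident log_partition_has_derivative[OF assms])
  then have grad: "partial_deriv i (\<lambda>\<xi>. p \<xi> x) \<theta> = p \<theta> x * (c x $ i - \<eta> \<theta> $ i)"
    by (simp add: partial_deriv_eq inner_axis')
  have "sqrt_tangent c \<theta> i x = p \<theta> x / (2 * sqrt (p \<theta> x)) * (c x $ i - \<eta> \<theta> $ i)"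
    by (simp add: sqrt_tangent_def grad)
  also have "p \<theta> x / (2 * sqrt (p \<theta> x)) = sqrt (p \<theta> x) / 2"
    using ef_density_pos[of c \<theta> x] by (simp add: field_simps)
  finally show ?thesis .
qed

section \<open>Tangent vectors of the family of square root densities\<close>

definition tangent_vector :: "real ^ 'n \<Rightarrow> real ^ 'n \<Rightarrow> real ^ 'N \<Rightarrow> real" where
  "tangent_vector \<theta> w x = (\<Sum>i\<in>UNIV. w $ i * sqrt_tangent c \<theta> i x)"

lemma tangent_vector_eq:
  assumes "\<theta> \<in> \<Theta>"
  shows "tangent_vector \<theta> w x = sqrt (p \<theta> x) / 2 * (w \<bullet> c x - w \<bullet> \<eta> \<theta>)"
  by (simp add: tangent_vector_def sqrt_tangent_eq[OF assms] inner_vec_def sum_distrib_left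
      sum_subtractf right_diff_distrib ac_simps)

lemma tangent_vector_diff:
  "tangent_vector \<theta> v x - tangent_vector \<theta> w x = tangent_vector \<theta> (v - w) x"
  by (simp add: tangent_vector_def sum_subtractf left_diff_distrib)

lemma
  assumes "\<theta> \<in> \<Theta>"
  shows L2_fun_tangent_vector: "L2_fun (tangent_vector \<theta> w)"
    and integral_tangent_vector_square:
      "(LINT x|lborel. (tangent_vector \<theta> w x)\<^sup>2) = w \<bullet> (F \<theta> *v w) / 4"
proof -
  note [measurable] = measurable_statistic[OF assms]
  define m where "m = w \<bullet> \<eta> \<theta>"
  have sq: "(tangent_vector \<theta> w x)\<^sup>2 = (p \<theta> x * ((w \<bullet> c x) * (w \<bullet> c x))
      - 2 * m * (p \<theta> x * (w \<bullet> c x)) + m\<^sup>2 * p \<theta> x) / 4" for x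
    using ef_density_pos[of c \<theta> x]
    by (simp add: tangent_vector_eq[OF assms] m_def power_mult_distrib power_divide power2_diff)
      (simp add: algebra_simps power2_eq_square)
  have int: "integrable lborel (\<lambda>x. p \<theta> x * ((w \<bullet> c x) * (w \<bullet> c x)))"
    "integrable lborel (\<lambda>x. p \<theta> x * (w \<bullet> c x))" "integrable lborel (p \<theta>)"
    by (simp_all add: assms integrable_density_inner integrable_density_inner_inner integrable_density)
  have "tangent_vector \<theta> w \<in> borel_measurable lborel"
    unfolding tangent_vector_eq[OF assms, abs_def] ef_density_def by measurable
  moreover have "integrable lborel (\<lambda>x. (tangent_vector \<theta> w x)\<^sup>2)"
    unfolding sq using int by simp
  ultimately show "L2_fun (tangent_vector \<theta> w)"
    by (simp add: L2_fun_def)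
  have "(LINT x|lborel. (tangent_vector \<theta> w x)\<^sup>2)
      = ((LINT x|lborel. p \<theta> x * ((w \<bullet> c x) * (w \<bullet> c x))) - 2 * m * m + m\<^sup>2) / 4"
    unfolding sq using int
    by (simp add: integral_density[OF assms] m_def inner_expectation_param[OF assms])
  also have "\<dots> = w \<bullet> (F \<theta> *v w) / 4"
    by (simp add: inner_fisher_matrix[OF assms] m_def power2_eq_square)
  finally show "(LINT x|lborel. (tangent_vector \<theta> w x)\<^sup>2) = w \<bullet> (F \<theta> *v w) / 4" .
qed

lemma sqrt_density_eq: "sqrt (p \<theta> x) = exp (((\<theta>, - \<psi> \<theta>) \<bullet> (c x, 1)) / 2)"
proof -
  have "p \<theta> x = (exp (((\<theta>, - \<psi> \<theta>) \<bullet> (c x, 1)) / 2))\<^sup>2"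
    by (simp add: ef_density_def flip: exp_double)
  then show ?thesis
    by (metis exp_ge_zero real_sqrt_unique)
qed

text \<open>The normalizing constant is absorbed into the exponent: \<open>\<surd>p\<close> is \<open>exp (\<phi> \<bullet> C / 2)\<close> for the
  statistic \<open>C = (c, 1)\<close> and the curve \<open>\<phi> = (\<theta>, - \<psi>(\<theta>))\<close>, which is differentiable by the chain
  rule. The estimate for unnormalized exponentials then applies without a product rule in
  \<open>L\<^sup>2\<close>.\<close>
lemma sqrt_density_has_L2_derivative:
  assumes curve: "\<And>s. s \<in> T \<Longrightarrow> \<theta> s \<in> \<Theta>" and "t \<in> T"
    and \<theta>: "(\<theta> has_vector_derivative \<theta>') (at t within T)"
  shows "has_L2_derivative (\<lambda>s x. sqrt (p (\<theta> s) x)) (tangent_vector (\<theta> t) \<theta>') t T"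
proof -
  have t: "\<theta> t \<in> \<Theta>" using curve \<open>t \<in> T\<close> .
  note [measurable] = measurable_statistic[OF t]
  define \<phi> where "\<phi> s = (\<theta> s, - \<psi> (\<theta> s))" for s
  define C where "C x = (c x, 1 :: real)" for x
  have C [measurable]: "C \<in> borel_measurable borel"
    unfolding C_def[abs_def] by measurable
  obtain \<epsilon> where \<epsilon>: "0 < \<epsilon>" "integrable lborel (\<lambda>x. exp (\<theta> t \<bullet> c x) * exp (\<epsilon> * norm (c x)))"
    using integrable_exp_norm_statistic[OF t] .
  have int: "integrable lborel (\<lambda>x. exp (\<phi> t \<bullet> C x) * exp (\<epsilon> * norm (C x)))"
  proof (rule Bochner_Integration.integrable_bound)
    show "integrable lborel (\<lambda>x. exp (\<epsilon> - \<psi> (\<theta> t)) * (exp (\<theta> t \<bullet> c x) * exp (\<epsilon> * norm (c x))))"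
      using \<epsilon>(2) by simp
    have "\<phi> t \<bullet> C x + \<epsilon> * norm (C x) \<le> \<epsilon> - \<psi> (\<theta> t) + (\<theta> t \<bullet> c x + \<epsilon> * norm (c x))" for x
    proof -
      have "\<epsilon> * norm (C x) \<le> \<epsilon> * (norm (c x) + 1)"
        using norm_Pair_le[of "c x" "1 :: real"] \<epsilon>(1) by (simp add: C_def)
      then show ?thesis
        by (simp add: \<phi>_def C_def distrib_left)
    qed
    then show "AE x in lborel. norm (exp (\<phi> t \<bullet> C x) * exp (\<epsilon> * norm (C x)))
        \<le> norm (exp (\<epsilon> - \<psi> (\<theta> t)) * (exp (\<theta> t \<bullet> c x) * exp (\<epsilon> * norm (c x))))"
      by (simp flip: exp_add)
  qed measurable
  have "((\<psi> \<circ> \<theta>) has_vector_derivative (\<theta>' \<bullet> \<eta> (\<theta> t))) (at t within T)"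
    by (rule vector_derivative_diff_chain_within[OF \<theta>])
      (rule has_derivative_at_withinI[OF log_partition_has_derivative[OF t]])
  then have \<phi>: "(\<phi> has_vector_derivative (\<theta>', - (\<theta>' \<bullet> \<eta> (\<theta> t)))) (at t within T)"
    unfolding \<phi>_def[abs_def] by (intro has_vector_derivative_Pair has_vector_derivative_minus \<theta>) (simp add: o_def)
  have V: "tangent_vector (\<theta> t) \<theta>' x = ((\<theta>', - (\<theta>' \<bullet> \<eta> (\<theta> t))) \<bullet> C x) / 2 * exp (\<phi> t \<bullet> C x / 2)" for x
    by (simp add: tangent_vector_eq[OF t] sqrt_density_eq \<phi>_def C_def)
  have "((\<lambda>s. LINT x|lborel. ((sqrt (p (\<theta> s) x) - sqrt (p (\<theta> t) x)) / (s - t)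
      - tangent_vector (\<theta> t) \<theta>' x)\<^sup>2) \<longlongrightarrow> 0) (at t within T)"
    using tendsto_L2_difference_quotient_exp[OF _ \<epsilon>(1) int \<phi>] C
    unfolding V by (simp add: sqrt_density_eq \<phi>_def C_def)
  from tendsto_real_sqrt[OF this]
  have "((\<lambda>s. L2_norm (\<lambda>x. (sqrt (p (\<theta> s) x) - sqrt (p (\<theta> t) x)) / (s - t)
      - tangent_vector (\<theta> t) \<theta>' x)) \<longlongrightarrow> 0) (at t within T)"
    by (simp add: L2_norm_def L2_inner_def flip: power2_eq_square)
  moreover have "L2_fun (\<lambda>x. sqrt (p (\<theta> s) x))" if "s \<in> T" for s
    using integrable_density[OF curve[OF that]] ef_density_pos[of c "\<theta> s"]
    by (auto simp: L2_fun_def less_imp_le dest: borel_measurable_integrable)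
  ultimately show ?thesis
    by (simp add: has_L2_derivative_def L2_fun_tangent_vector[OF t])
qed

section \<open>Coordinates of the two vector fields\<close>
text \<open>Along the segment from \<open>a\<close> to \<open>b\<close> the function \<open>(b - a) \<bullet> \<eta>\<close> has the derivative
  \<open>(b - a) \<bullet> F (b - a) > 0\<close>, so it cannot take the same value at both ends.\<close>
lemma expectation_param_inj_on:
  assumes fisher: "\<And>\<theta>. \<theta> \<in> \<Theta> \<Longrightarrow> pos_definite (F \<theta>)"
  shows "inj_on \<eta> \<Theta>"
proof (rule inj_onI, rule ccontr)
  fix a b assume ab: "a \<in> \<Theta>" "b \<in> \<Theta>" "\<eta> a = \<eta> b" "a \<noteq> b"
  define v where "v = b - a"
  define \<gamma> where "\<gamma> s = a + s *\<^sub>R v" for s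
  have \<gamma>: "\<gamma> s \<in> \<Theta>" if "0 \<le> s" "s \<le> 1" for s
  proof -
    have "\<gamma> s = (1 - s) *\<^sub>R a + s *\<^sub>R b"
      by (simp add: \<gamma>_def v_def algebra_simps)
    then show ?thesis
      using family ab that by (simp add: exponential_family_def convexD)
  qed
  have "v \<bullet> \<eta> (\<gamma> 0) < v \<bullet> \<eta> (\<gamma> 1)"
  proof (rule DERIV_pos_imp_increasing[where f = "\<lambda>s. v \<bullet> \<eta> (\<gamma> s)"])
    fix s :: real assume s: "0 \<le> s" "s \<le> 1"
    have \<gamma>': "(\<gamma> has_vector_derivative v) (at s)"
      unfolding \<gamma>_def[abs_def] by (auto intro!: derivative_eq_intros)
    have "((\<eta> \<circ> \<gamma>) has_vector_derivative (F (\<gamma> s) *v v)) (at s)"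
      by (rule vector_derivative_diff_chain_within[OF \<gamma>'])
        (rule has_derivative_at_withinI[OF expectation_param_has_derivative[OF \<gamma>[OF s]]])
    then have "((\<lambda>s. v \<bullet> \<eta> (\<gamma> s)) has_real_derivative v \<bullet> (F (\<gamma> s) *v v)) (at s)"
      using bounded_linear.has_vector_derivative[OF bounded_linear_inner_right]
      by (fastforce simp: has_real_derivative_iff_has_vector_derivative o_def)
    moreover have "0 < v \<bullet> (F (\<gamma> s) *v v)"
      using fisher[OF \<gamma>[OF s]] ab by (simp add: pos_definite_def v_def)
    ultimately show "\<exists>y. ((\<lambda>s. v \<bullet> \<eta> (\<gamma> s)) has_real_derivative y) (at s) \<and> 0 < y"
      by blast
  qed simp
  then show False
    using ab by (simp add: \<gamma>_def v_def)
qed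

lemma ef_density_of_expectation_eq:
  assumes "\<And>\<theta>. \<theta> \<in> \<Theta> \<Longrightarrow> pos_definite (F \<theta>)" and "\<theta> \<in> \<Theta>"
  shows "ef_density_of_expectation c \<Theta> (\<eta> \<theta>) = p \<theta>"
  unfolding ef_density_of_expectation_def
  using expectation_param_inj_on[OF assms(1)] assms(2)
  by (intro the_equality) (auto dest: inj_onD)

text \<open>The square roots cancel in the product with the tangent vector and leave
  \<open>(c\<^sub>j - \<eta>\<^sub>j) \<L>\<^sup>*p / 4\<close>. Integration by parts against \<open>c\<^sub>j\<close> gives the mean of \<open>\<L>c\<^sub>j\<close>, and against
  the constant 1 it gives 0. The factor 4 is the one in front of \<open>g\<^sup>i\<^sup>j\<close> in the projection.\<close>
lemma L2_inner_sqrt_tangent_FPK_operator: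
  assumes \<theta>: "\<theta> \<in> \<Theta>"
    and parts_one: "integration_by_parts f \<sigma> t (p \<theta>) (\<lambda>x. 1)"
    and parts_c: "\<And>i. integration_by_parts f \<sigma> t (p \<theta>) (\<lambda>x. c x $ i)"
  shows "4 * L2_inner (\<lambda>x. FPK_operator f \<sigma> t (p \<theta>) x / (2 * sqrt (p \<theta> x))) (sqrt_tangent c \<theta> j)
    = expect (p \<theta>) (FPK_adjoint_vec f \<sigma> t c) $ j"
proof -
  define L where "L = FPK_operator f \<sigma> t (p \<theta>)"
  have one: "integrable lborel L" "integral\<^sup>L lborel L = 0"
    using parts_one by (simp_all add: integration_by_parts_def L_def FPK_adjoint_one)
  have int: "integrable lborel (\<lambda>x. c x $ i * L x)"
    and adj: "integrable lborel (\<lambda>x. FPK_adjoint f \<sigma> t (\<lambda>y. c y $ i) x * p \<theta> x)"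
    and eq: "(LINT x|lborel. c x $ i * L x) = (LINT x|lborel. FPK_adjoint f \<sigma> t (\<lambda>y. c y $ i) x * p \<theta> x)" for i
    using parts_c[of i] by (simp_all add: integration_by_parts_def L_def)
  have "L x / (2 * sqrt (p \<theta> x)) * sqrt_tangent c \<theta> j x = (c x $ j * L x - \<eta> \<theta> $ j * L x) / 4" for x
    using ef_density_pos[of c \<theta> x] by (simp add: sqrt_tangent_eq[OF \<theta>] algebra_simps)
  then have "4 * L2_inner (\<lambda>x. L x / (2 * sqrt (p \<theta> x))) (sqrt_tangent c \<theta> j)
      = (LINT x|lborel. c x $ j * L x - \<eta> \<theta> $ j * L x)"
    unfolding L2_inner_def by (simp only:) simp
  also have "\<dots> = (LINT x|lborel. FPK_adjoint f \<sigma> t (\<lambda>y. c y $ j) x * p \<theta> x)"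
    using int one by (simp add: eq)
  also have "\<dots> = expect (p \<theta>) (FPK_adjoint_vec f \<sigma> t c) $ j"
  proof -
    have "p \<theta> x *\<^sub>R FPK_adjoint_vec f \<sigma> t c x
        = (\<Sum>i\<in>UNIV. (FPK_adjoint f \<sigma> t (\<lambda>y. c y $ i) x * p \<theta> x) *\<^sub>R axis i 1)" for x
      by (simp add: vec_eq_iff FPK_adjoint_vec_def axis_def if_distrib cong: if_cong)
    then have "expect (p \<theta>) (FPK_adjoint_vec f \<sigma> t c)
        = (\<Sum>i\<in>UNIV. (LINT x|lborel. FPK_adjoint f \<sigma> t (\<lambda>y. c y $ i) x * p \<theta> x) *\<^sub>R axis i 1)"
      using adj by (simp add: expect_def Bochner_Integration.integral_sum)
    then show ?thesis
      by (simp add: axis_def if_distrib cong: if_cong)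
  qed
  finally show ?thesis by (simp add: L_def)
qed

lemma tangent_projection_eq:
  assumes "\<And>j. 4 * L2_inner v (sqrt_tangent c \<theta> j) = b $ j"
  shows "tangent_projection c \<theta> v = tangent_vector \<theta> (matrix_inv (F \<theta>) *v b)"
  by (simp add: fun_eq_iff tangent_projection_def tangent_vector_def matrix_vector_mult_def
      ac_simps flip: assms)

text \<open>Distinct coordinates give distinct classes in \<open>L\<^sup>2\<close>, because the squared distance of the
  tangent vectors is a quarter of the Fisher form of the difference of their coordinates.\<close>
lemma sqrt_density_has_L2_derivative_iff:
  assumes fisher: "pos_definite (F (\<theta> t))"
    and curve: "\<And>s. s \<in> T \<Longrightarrow> \<theta> s \<in> \<Theta>" and t: "t \<in> T"
    and \<theta>: "(\<theta> has_vector_derivative \<theta>') (at t within T)" and nontriv: "at t within T \<noteq> bot"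
  shows "has_L2_derivative (\<lambda>s x. sqrt (p (\<theta> s) x)) (tangent_vector (\<theta> t) w) t T \<longleftrightarrow> w = \<theta>'"
proof
  assume "has_L2_derivative (\<lambda>s x. sqrt (p (\<theta> s) x)) (tangent_vector (\<theta> t) w) t T"
  from has_L2_derivative_unique[OF this sqrt_density_has_L2_derivative[OF curve t \<theta>] t nontriv]
  have "(w - \<theta>') \<bullet> (F (\<theta> t) *v (w - \<theta>')) = 0"
    by (simp add: tangent_vector_diff integral_tangent_vector_square[OF curve[OF t]])
  then show "w = \<theta>'"
    using fisher by (metis pos_definite_def less_irrefl right_minus_eq)
qed (use sqrt_density_has_L2_derivative[OF curve t \<theta>] in simp)

lemma expectation_param_has_vector_derivative_iff:
  assumes "\<theta> t \<in> \<Theta>"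
    and \<theta>: "(\<theta> has_vector_derivative \<theta>') (at t within T)" and nontriv: "at t within T \<noteq> bot"
  shows "((\<lambda>s. \<eta> (\<theta> s)) has_vector_derivative b) (at t within T) \<longleftrightarrow> b = F (\<theta> t) *v \<theta>'"
proof -
  have "((\<eta> \<circ> \<theta>) has_vector_derivative F (\<theta> t) *v \<theta>') (at t within T)"
    by (rule vector_derivative_diff_chain_within[OF \<theta>])
      (rule has_derivative_at_withinI[OF expectation_param_has_derivative[OF assms(1)]])
  then show ?thesis
    using vector_derivative_unique_within[OF nontriv] by (auto simp: o_def)
qed

end

theorem theorem4p2:
  fixes f :: "real ^ 'N \<Rightarrow> real \<Rightarrow> real ^ 'N"
    and \<sigma> :: "real ^ 'N \<Rightarrow> real \<Rightarrow> real ^ 'm ^ 'N"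
    and c :: "real ^ 'N \<Rightarrow> real ^ 'n"
    and \<Theta> :: "(real ^ 'n) set"
    and T :: "real set"
    and \<theta> :: "real \<Rightarrow> real ^ 'n"
  assumes family: "exponential_family c \<Theta>"
    and fisher: "\<And>\<theta>. \<theta> \<in> \<Theta> \<Longrightarrow> pos_definite (fisher_matrix c \<theta>)"
    and parts_one: "\<And>t \<theta>. 0 \<le> t \<Longrightarrow> \<theta> \<in> \<Theta> \<Longrightarrow>
          integration_by_parts f \<sigma> t (ef_density c \<theta>) (\<lambda>x. 1)"
    and parts_c: "\<And>t \<theta> i. 0 \<le> t \<Longrightarrow> \<theta> \<in> \<Theta> \<Longrightarrow>
          integration_by_parts f \<sigma> t (ef_density c \<theta>) (\<lambda>x. c x $ i)"
    and L2_bound: "\<And>\<theta>. \<theta> \<in> \<Theta> \<Longrightarrow>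
          (SUP t\<in>{0..}. \<integral>\<^sup>+ x. ennreal (\<bar>FPK_operator f \<sigma> t (ef_density c \<theta>) x / ef_density c \<theta> x\<bar>\<^sup>2
                                    * ef_density c \<theta> x) \<partial>lborel) < \<infinity>"
    and time: "is_interval T" "T \<subseteq> {0..}"
    and curve: "\<And>t. t \<in> T \<Longrightarrow> \<theta> t \<in> \<Theta>" "\<theta> differentiable_on T"
  shows "tangent_projected_equation f \<sigma> c T \<theta> \<longleftrightarrow>
         assumed_density_equation f \<sigma> c \<Theta> T (\<lambda>t. expectation_param c (\<theta> t))"
proof -
  interpret exp_family c \<Theta>
    by unfold_locales (rule family)
  define b where "b t = expect (p (\<theta> t)) (FPK_adjoint_vec f \<sigma> t c)" for t
  have projection: "tangent_projection c (\<theta> t)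
        (\<lambda>x. FPK_operator f \<sigma> t (p (\<theta> t)) x / (2 * sqrt (p (\<theta> t) x)))
      = tangent_vector (\<theta> t) (matrix_inv (F (\<theta> t)) *v b t)" if "t \<in> T" for t
  proof -
    have "0 \<le> t" using that time(2) by auto
    then show ?thesis
      unfolding b_def using curve(1)[OF that]
      by (intro tangent_projection_eq L2_inner_sqrt_tangent_FPK_operator parts_one parts_c)
  qed
  have closure: "expect (ef_density_of_expectation c \<Theta> (\<eta> (\<theta> t))) (FPK_adjoint_vec f \<sigma> t c) = b t"
    if "t \<in> T" for t
    using ef_density_of_expectation_eq[OF fisher curve(1)[OF that]] by (simp add: b_def)
  have "has_L2_derivative (\<lambda>s x. sqrt (p (\<theta> s) x))
        (tangent_vector (\<theta> t) (matrix_inv (F (\<theta> t)) *v b t)) t T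
      \<longleftrightarrow> ((\<lambda>s. \<eta> (\<theta> s)) has_vector_derivative b t) (at t within T)" if t: "t \<in> T" for t
  proof (cases "T = {t}")
    case True
    \<comment> \<open>On a one-point time set every candidate derivative is a derivative, so both sides hold.\<close>
    then have bot: "at t within T = bot"
      by (simp add: at_within_eq_bot_iff)
    have "(\<theta> has_vector_derivative 0) (at t within T)"
      "((\<lambda>s. \<eta> (\<theta> s)) has_vector_derivative b t) (at t within T)"
      by (simp_all add: bot has_vector_derivative_def has_derivative_def bounded_linear_scaleR_left)
    then show ?thesis
      using sqrt_density_has_L2_derivative[OF curve(1) t, where \<theta>' = "matrix_inv (F (\<theta> t)) *v b t"]
      by (simp add: bot has_vector_derivative_def has_derivative_def bounded_linear_scaleR_left)
  next
    case False
    then have nontriv: "at t within T \<noteq> bot"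
    proof -
      have "T \<noteq> {x}" for x
        using False t by auto
      then have "t islimpt T"
        using time(1) t by (intro connected_imp_perfect) (auto simp: is_interval_connected_1)
      then show ?thesis
        by (simp add: trivial_limit_within)
    qed
    obtain \<theta>' where \<theta>': "(\<theta> has_vector_derivative \<theta>') (at t within T)"
      using curve(2) t by (meson differentiable_on_def vector_derivative_works)
    have "matrix_inv (F (\<theta> t)) *v b t = \<theta>' \<longleftrightarrow> b t = F (\<theta> t) *v \<theta>'"
      using pos_definite_matrix_inv[OF fisher[OF curve(1)[OF t]]] by metis
    then show ?thesis
      by (simp add: sqrt_density_has_L2_derivative_iff[OF fisher[OF curve(1)[OF t]] curve(1) t \<theta>' nontriv]
        expectation_param_has_vector_derivative_iff[where \<theta> = \<theta>, OF curve(1)[OF t] \<theta>' nontriv])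
  qed
  then show ?thesis
    by (simp add: tangent_projected_equation_def assumed_density_equation_def moment_equation_def
        projection closure)
qed

end
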